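(* Let $n$ be a positive integer and let $\Gamma$ be an Abelian group of order $n^2>1$. There exists a (non-trivial) zero-sum $\Gamma$-magic square of side $n$ if and only if $n>2$ and $\Gamma\in\mathcal{G}$, where $\mathcal{G}$ is the set of all finite Abelian groups that have odd order or contain more than one involution.
   Context: An Abelian group $(\Gamma,+)$ has identity $0$. An involution of $\Gamma$ is an element $\iota\neq 0$ with $2\iota=0$. The set $\mathcal{G}$ consists of all finite Abelian groups that are of odd order (hence have no involution) or contain more than one involution. For an Abelian group $\Gamma$ of order $n^2$, a $\Gamma$-magic square of side $n$ is an $n\times n$ array whose entries are the elements of $\Gamma$, each appearing exactly once, such that all row sums, all column sums, the main diagonal sum and the main antidiagonal sum are equal to the same element $\mu\in\Gamma$, called the magic constant. A zero-sum $\Gamma$-magic square is a $\Gamma$-magic square with magic constant $\mu=0$. The square is trivial if $n=1$ and non-trivial otherwise. *)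

theory Defs
  imports "HOL-Algebra.Algebra"
begin

text \<open>
  Abelian groups are the commutative groups of HOL-Algebra, which are written multiplicatively:
  the neutral element $0$ is \<open>\<one>\<close>, $2\iota$ is \<open>\<iota> \<otimes> \<iota>\<close>, and a finite sum is a \<open>finprod\<close>.
\<close>

definition involutions :: "('a, 'b) monoid_scheme \<Rightarrow> 'a set" where
  "involutions G = {x \<in> carrier G. x \<noteq> \<one>\<^bsub>G\<^esub> \<and> x \<otimes>\<^bsub>G\<^esub> x = \<one>\<^bsub>G\<^esub>}"

definition class_G :: "('a, 'b) monoid_scheme \<Rightarrow> bool" where
  "class_G G \<longleftrightarrow> comm_group G \<and> finite (carrier G) \<and>
     (odd (order G) \<or> card (involutions G) > 1)"

text \<open>
  Rows and columns are indexed by \<open>0, \<dots>, n - 1\<close>; values of \<open>A\<close> outside this range are irrelevant.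
\<close>

definition magic_square :: "('a, 'b) monoid_scheme \<Rightarrow> nat \<Rightarrow> (nat \<Rightarrow> nat \<Rightarrow> 'a) \<Rightarrow> 'a \<Rightarrow> bool" where
  "magic_square G n A \<mu> \<longleftrightarrow>
     bij_betw (\<lambda>(i, j). A i j) ({..<n} \<times> {..<n}) (carrier G) \<and>
     \<mu> \<in> carrier G \<and>
     (\<forall>i<n. finprod G (\<lambda>j. A i j) {..<n} = \<mu>) \<and>
     (\<forall>j<n. finprod G (\<lambda>i. A i j) {..<n} = \<mu>) \<and>
     finprod G (\<lambda>i. A i i) {..<n} = \<mu> \<and>
     finprod G (\<lambda>i. A i (n - 1 - i)) {..<n} = \<mu>"

definition zero_sum_magic_square :: "('a, 'b) monoid_scheme \<Rightarrow> nat \<Rightarrow> (nat \<Rightarrow> nat \<Rightarrow> 'a) \<Rightarrow> bool" where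
  "zero_sum_magic_square G n A \<longleftrightarrow> magic_square G n A \<one>\<^bsub>G\<^esub>"

end

theory Submission
  imports Defs
begin

text \<open>
  The product of all rows of a zero-sum square is the product of all group elements. Pairing each
  element with its inverse leaves the product of the involutions, which is not the identity when
  there is just one; this gives necessity.

  For odd \<open>n\<close>, take a subgroup \<open>H\<close> of order \<open>n\<close> and coset representatives \<open>r\<close> with product one:
  the entries \<open>r (i + j + 1) h (i - j)\<close>, with indices modulo \<open>n\<close> and \<open>h\<close> running through \<open>H\<close>, form
  a zero-sum square. For \<open>n = 2 m\<close> with \<open>m\<close> odd, the group is the product of a Klein four-group and
  a group of order \<open>m\<^sup>2\<close>; each entry of a square of the latter is replaced by a two-by-two block
  carrying a suitably permuted copy of the Klein group. For \<open>n = 4 k\<close>, the group is cut into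
  \<open>k\<^sup>2\<close> zero-sum four-by-four tiles, each a union of four cosets of a Klein four-group, and the tiles
  are laid out symmetrically about the centre, so that both diagonals of the square are composed of
  diagonals of tiles.
\<close>

section \<open>Finite products in abelian groups\<close>

text \<open>Each construction only proves that its cells cover the group. There are as many cells as
  elements, so bijectivity follows by counting, and blocks, dominoes and tiles need no distinctness
  conditions.

  The delicate case is \<open>n = 4 k\<close> with every involution inside the Klein group
  \<open>V\<close>. A coset of x with x^2 in \<open>V\<close> is then its own inverse, and no
  involution outside \<open>V\<close> is available to shift it. Such cosets are classified by the
  value x^2, so there are as many of them as squares lying in \<open>V\<close>. One is impossible:
  the rest of the group, of 16 m - 4 elements, would be cut into sets of eight. Three is impossible,
  since x^2 y^2 is again a square. With four, these cosets form a copy of Z_4 x Z_4, which has a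
  zero-sum square of its own; with two, a pair of mutually inverse cosets is added to fill a tile.
  Removing this one tile leaves a set on which pairing by inversion works.\<close>

lemma (in comm_group) finprod_inverse_pairs:
  assumes "finite S" "S \<subseteq> carrier G" "\<And>x. x \<in> S \<Longrightarrow> inv x \<in> S \<and> inv x \<noteq> x"
  shows "finprod G (\<lambda>x. x) S = \<one> \<and> even (card S)"
  using assms
proof (induction "card S" arbitrary: S rule: less_induct)
  case less
  show ?case
  proof (cases "S = {}")
    case False
    then obtain x where x: "x \<in> S" by blast
    then have xG: "x \<in> carrier G" "inv x \<in> S" "inv x \<noteq> x" using less.prems by auto
    define T where "T = S - {x, inv x}"
    have S: "S = insert x (insert (inv x) T)" "x \<notin> insert (inv x) T" "inv x \<notin> T"
      using x xG by (auto simp: T_def)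
    have T: "finite T" "T \<subseteq> carrier G" using less.prems by (auto simp: T_def)
    have card: "card S = Suc (Suc (card T))"
      using S T by simp
    have "inv y \<in> T \<and> inv y \<noteq> y" if "y \<in> T" for y
    proof -
      have y: "y \<in> S" "y \<noteq> x" "y \<noteq> inv x" "y \<in> carrier G" using that T by (auto simp: T_def)
      then have "inv y \<noteq> x" "inv y \<noteq> inv x" using xG(1) inv_inv by metis+
      then show ?thesis using y less.prems(3) by (auto simp: T_def)
    qed
    then have "finprod G (\<lambda>x. x) T = \<one> \<and> even (card T)"
      using less.hyps T card by simp
    moreover have "finprod G (\<lambda>x. x) S = x \<otimes> (inv x \<otimes> finprod G (\<lambda>x. x) T)"
      using S T xG by (simp add: Pi_def subset_iff)
    ultimately show ?thesis using xG card by simp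
  qed simp
qed

lemma (in comm_group) finprod_carrier_involutions:
  assumes "finite (carrier G)"
  shows "finprod G (\<lambda>x. x) (carrier G) = finprod G (\<lambda>x. x) (involutions G)"
    and "even (order G) \<longleftrightarrow> odd (card (involutions G))"
proof -
  define S where "S = {x \<in> carrier G. x \<otimes> x \<noteq> \<one>}"
  have eq: "inv x = x \<longleftrightarrow> x \<otimes> x = \<one>" if "x \<in> carrier G" for x
    using that by (metis inv_equality l_inv)
  have fin: "finite S" "finite (involutions G)" "S \<subseteq> carrier G" "involutions G \<subseteq> carrier G"
    using assms by (auto simp: S_def involutions_def)
  have "inv x \<in> S \<and> inv x \<noteq> x" if "x \<in> S" for x
    using that eq[of x] eq[of "inv x"] unfolding S_def by auto
  then have S: "finprod G (\<lambda>x. x) S = \<one>" "even (card S)"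
    using finprod_inverse_pairs fin by simp_all
  have c: "carrier G = insert \<one> (S \<union> involutions G)"
    by (auto simp: S_def involutions_def)
  have n: "\<one> \<notin> S \<union> involutions G" "S \<inter> involutions G = {}"
    by (auto simp: S_def involutions_def)
  have "finprod G (\<lambda>x. x) (carrier G) = finprod G (\<lambda>x. x) (S \<union> involutions G)"
    by (subst c, subst finprod_insert) (use fin n in \<open>auto intro!: l_one finprod_closed\<close>)
  also have "\<dots> = finprod G (\<lambda>x. x) (involutions G)"
    using fin n S by (subst finprod_Un_disjoint) (auto simp: Pi_def subset_iff)
  finally show "finprod G (\<lambda>x. x) (carrier G) = finprod G (\<lambda>x. x) (involutions G)" .
  have "order G = Suc (card S + card (involutions G))"
    unfolding order_def by (subst c) (use fin n in \<open>auto simp: card_Un_disjoint\<close>)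
  then show "even (order G) \<longleftrightarrow> odd (card (involutions G))" using S by simp
qed

text \<open>An involution x would satisfy x = \<open>x [^] order G\<close> = \<open>\<one>\<close>,
  the order being odd. Besides subgroups, this is applied to a quotient group.\<close>

lemma (in comm_group) finprod_carrier_odd:
  assumes "odd (order G)"
  shows "finprod G (\<lambda>x. x) (carrier G) = \<one>"
proof -
  have fin: "finite (carrier G)" using assms by (metis card.infinite even_zero order_def)
  have "involutions G = {}"
  proof (rule ccontr)
    assume "involutions G \<noteq> {}"
    then obtain x where x: "x \<in> carrier G" "x \<noteq> \<one>" "x \<otimes> x = \<one>"
      by (auto simp: involutions_def)
    from assms obtain k where k: "order G = 2 * k + 1" by (rule oddE)
    have "x [^] (2 * k) = (x [^] (2::nat)) [^] k" using x by (simp add: nat_pow_pow)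
    also have "\<dots> = \<one>" using x by (simp add: numeral_2_eq_2)
    finally have "x [^] order G = x" using x by (simp add: k)
    then show False using x fin pow_order_eq_1 by simp
  qed
  then show ?thesis using finprod_carrier_involutions(1)[OF fin] by simp
qed

lemma (in comm_group) hom_finprod:
  assumes "comm_group H" "h \<in> hom G H" "f \<in> A \<rightarrow> carrier G"
  shows "h (finprod G f A) = finprod H (\<lambda>x. h (f x)) A"
proof -
  interpret H: comm_group H by fact
  interpret group_hom G H h
    using assms by unfold_locales
  show ?thesis
    using assms(3)
  proof (induction A rule: infinite_finite_induct)
    case (insert x A)
    then show ?case by (auto simp: Pi_def)
  qed auto
qed

lemma (in comm_monoid) finprod_lessThan_pairs:
  fixes k :: nat
  assumes "f \<in> {..<2 * k} \<rightarrow> carrier G"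
  shows "finprod G f {..<2 * k} = (\<Otimes>q\<in>{..<k}. f (2 * q) \<otimes> f (2 * q + 1))"
  using assms
proof (induction k)
  case (Suc k)
  have "finprod G f {..<2 * Suc k} = f (Suc (2 * k)) \<otimes> (f (2 * k) \<otimes> finprod G f {..<2 * k})"
    using Suc.prems by (simp add: lessThan_Suc Pi_def)
  then show ?case
    using Suc by (simp add: lessThan_Suc Pi_def m_ac)
qed simp

lemma (in comm_monoid) finprod_lessThan_rev:
  fixes n :: nat
  assumes "f \<in> {..<n} \<rightarrow> carrier G"
  shows "finprod G f {..<n} = (\<Otimes>i\<in>{..<n}. f (n - 1 - i))"
proof -
  have inj: "inj_on (\<lambda>i. n - 1 - i) {..<n}" by (auto simp: inj_on_def)
  have "(\<lambda>i. n - 1 - i) ` {..<n} \<subseteq> {..<n}" by auto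
  then have "(\<lambda>i. n - 1 - i) ` {..<n} = {..<n}"
    by (intro endo_inj_surj inj) auto
  with finprod_reindex[of f "\<lambda>i. n - 1 - i" "{..<n}"] inj assms show ?thesis by simp
qed

text \<open>Pairing an index with its mirror image prepares the layout of tiles that is symmetric
  about the centre.\<close>

lemma (in comm_monoid) finprod_lessThan_folded:
  fixes m :: nat
  assumes f: "f \<in> {..<2 * m} \<rightarrow> carrier G"
  shows "finprod G f {..<2 * m} = (\<Otimes>i\<in>{..<m}. f i \<otimes> f (2 * m - 1 - i))"
proof -
  have U: "{..<2 * m} = {..<m} \<union> {m..<2 * m}" by auto
  have im: "(\<lambda>i. i + m) ` {..<m} = {m..<2 * m}"
    unfolding lessThan_atLeast0 by (simp add: mult_2)
  have "finprod G f {m..<2 * m} = (\<Otimes>i\<in>{..<m}. f (i + m))"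
    unfolding im[symmetric] by (rule finprod_reindex) (use f in \<open>auto simp: Pi_def\<close>)
  also have "\<dots> = (\<Otimes>i\<in>{..<m}. f (m - 1 - i + m))"
    by (rule finprod_lessThan_rev[of "\<lambda>i. f (i + m)"]) (use f in \<open>auto simp: Pi_def\<close>)
  also have "\<dots> = (\<Otimes>i\<in>{..<m}. f (2 * m - 1 - i))"
    by (rule finprod_cong') (use f in \<open>auto simp: Pi_def mult_2 intro!: arg_cong[of _ _ f]\<close>)
  finally have *: "finprod G f {m..<2 * m} = (\<Otimes>i\<in>{..<m}. f (2 * m - 1 - i))" .
  have "finprod G f {..<2 * m} = finprod G f {..<m} \<otimes> finprod G f {m..<2 * m}"
    unfolding U by (rule finprod_Un_disjoint) (use f in \<open>auto simp: Pi_def\<close>)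
  with * show ?thesis using f by (simp add: Pi_def)
qed

section \<open>Necessity\<close>

lemma (in comm_group) magic_square_imp_class_G:
  assumes "n > 0" "order G = n\<^sup>2" "zero_sum_magic_square G n A"
  shows "class_G G"
proof -
  have fin: "finite (carrier G)"
    using assms(1,2) by (metis card.infinite order_def zero_less_power less_irrefl)
  have bij: "bij_betw (\<lambda>(i, j). A i j) ({..<n} \<times> {..<n}) (carrier G)"
    and row: "\<And>i. i < n \<Longrightarrow> finprod G (\<lambda>j. A i j) {..<n} = \<one>"
    using assms(3) by (auto simp: zero_sum_magic_square_def magic_square_def)
  have inj: "A i j = A k l \<longleftrightarrow> i = k \<and> j = l" if "i < n" "j < n" "k < n" "l < n" for i j k l
    using bij that by (auto simp: bij_betw_def inj_on_def)
  have AG: "A i j \<in> carrier G" if "i < n" "j < n" for i j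
    using bij that by (auto simp: bij_betw_def)
  have c: "carrier G = (\<Union>i\<in>{..<n}. A i ` {..<n})"
    using bij by (force simp: bij_betw_def)
  have "finprod G (\<lambda>x. x) (carrier G) = (\<Otimes>i\<in>{..<n}. finprod G (\<lambda>x. x) (A i ` {..<n}))"
    unfolding c by (rule finprod_UN_disjoint) (auto simp: pairwise_def disjnt_def inj AG)
  also have "\<dots> = \<one>"
  proof (rule finprod_one_eqI)
    fix i assume "i \<in> {..<n}"
    then have i: "i < n" by simp
    have "finprod G (\<lambda>x. x) (A i ` {..<n}) = (\<Otimes>j\<in>{..<n}. A i j)"
      by (rule finprod_reindex) (use i in \<open>auto simp: inj_on_def inj AG\<close>)
    then show "finprod G (\<lambda>x. x) (A i ` {..<n}) = \<one>" using row i by simp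
  qed
  finally have P: "finprod G (\<lambda>x. x) (involutions G) = \<one>"
    using finprod_carrier_involutions(1)[OF fin] by simp
  have "card (involutions G) \<noteq> 1"
  proof
    assume "card (involutions G) = 1"
    then obtain x where x: "involutions G = {x}" by (auto simp: card_1_singleton_iff)
    then have "x \<in> carrier G" "x \<noteq> \<one>" by (auto simp: involutions_def)
    then show False using P x by simp
  qed
  \<comment> \<open>An even order makes the number of involutions odd, hence positive; as it is not
    one, it is larger.\<close>
  then have "odd (order G) \<or> card (involutions G) > 1"
    using finprod_carrier_involutions(2)[OF fin] by (cases "card (involutions G)") auto
  then show ?thesis using fin comm_group_axioms by (simp add: class_G_def)
qed

text \<open>The first row and the first column share the corner entry; cancelling it makes two
  different cells equal.\<close>

lemma (in comm_group) no_magic_square_2: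
  assumes "zero_sum_magic_square G 2 A"
  shows False
proof -
  have bij: "bij_betw (\<lambda>(i, j). A i j) ({..<2} \<times> {..<2}) (carrier G)"
    and row: "finprod G (\<lambda>j. A 0 j) {..<2} = \<one>"
    and col: "finprod G (\<lambda>i. A i 0) {..<2} = \<one>"
    using assms by (auto simp: zero_sum_magic_square_def magic_square_def)
  have AG: "A i j \<in> carrier G" if "i < 2" "j < 2" for i j
    using bij that by (auto simp: bij_betw_def)
  have "A 0 1 \<otimes> A 0 0 = \<one>" "A 1 0 \<otimes> A 0 0 = \<one>"
    using row col AG by (simp_all add: numeral_2_eq_2 lessThan_Suc Pi_def)
  then have "A 0 1 = A 1 0" using AG r_cancel[of "A 0 1" "A 0 0" "A 1 0"] by simp
  moreover have "inj_on (\<lambda>(i, j). A i j) ({..<2} \<times> {..<2})" using bij by (simp add: bij_betw_def)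
  then have "(0::nat, 1::nat) = (1, 0)" if "A 0 1 = A 1 0" by (rule inj_onD) (use that in auto)
  ultimately show False by simp
qed

section \<open>Subgroups and coset representatives\<close>

lemma (in comm_group) subgroup_is_comm_group:
  assumes "subgroup H G"
  shows "comm_group (G\<lparr>carrier := H\<rparr>)"
proof -
  interpret H: group "G\<lparr>carrier := H\<rparr>" using assms by (rule subgroup_imp_group)
  show ?thesis
    by (rule H.group_comm_groupI) (use subgroup.subset[OF assms] in \<open>auto intro: m_comm\<close>)
qed

lemma (in comm_group) finprod_subgroup:
  assumes "subgroup H G" "f \<in> A \<rightarrow> H"
  shows "finprod (G\<lparr>carrier := H\<rparr>) f A = finprod G f A"
proof -
  interpret H: comm_group "G\<lparr>carrier := H\<rparr>"
    by (rule subgroup_is_comm_group) fact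
  have "(\<lambda>x. x) \<in> hom (G\<lparr>carrier := H\<rparr>) G"
    using subgroup.subset[OF assms(1)] by (auto simp: hom_def)
  from H.hom_finprod[OF comm_group_axioms this, of f A] assms(2) show ?thesis by simp
qed

text \<open>By Lagrange the intersection is trivial, so the factorisation h k of an element of
  \<open>H <#> K\<close> is unique.\<close>

lemma (in comm_group) card_set_mult_coprime:
  assumes "finite (carrier G)" "subgroup H G" "subgroup K G" "coprime (card H) (card K)"
  shows "card (H <#> K) = card H * card K"
proof -
  interpret H: subgroup H G by fact
  interpret K: subgroup K G by fact
  have fin: "finite H" "finite K" using assms(1) H.subset K.subset finite_subset by auto
  have HK: "subgroup (H \<inter> K) G" using subgroups_Inter_pair assms by simp
  have "card (H \<inter> K) dvd card H" "card (H \<inter> K) dvd card K"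
    using group.lagrange[OF subgroup_imp_group[OF assms(2)], of "H \<inter> K"]
      group.lagrange[OF subgroup_imp_group[OF assms(3)], of "H \<inter> K"]
      subgroup_incl[OF HK assms(2)] subgroup_incl[OF HK assms(3)]
    by (simp_all add: order_def) (metis dvd_triv_right)+
  then have "card (H \<inter> K) = 1" using assms(4) by (metis coprime_common_divisor_nat)
  then have triv: "x = \<one>" if "x \<in> H" "x \<in> K" for x
    using that by (metis H.one_closed IntI K.one_closed card_1_singletonE singletonD)
  have "inj_on (\<lambda>(h, k). h \<otimes> k) (H \<times> K)"
  proof (rule inj_onI, clarsimp)
    fix h k h' k' assume h: "h \<in> H" "h' \<in> H" and k: "k \<in> K" "k' \<in> K" and eq: "h \<otimes> k = h' \<otimes> k'"
    have G: "h \<in> carrier G" "h' \<in> carrier G" "k \<in> carrier G" "k' \<in> carrier G" using h k by auto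
    have "h = h' \<otimes> (k' \<otimes> inv k)"
      using G eq inv_solve_right'[of h "h' \<otimes> k'" k] by (simp add: m_assoc)
    then have e: "inv h' \<otimes> h = k' \<otimes> inv k"
      using G inv_solve_left'[of "k' \<otimes> inv k" h' h] by simp
    have "inv h' \<otimes> h \<in> H" "k' \<otimes> inv k \<in> K" using h k by auto
    then have "inv h' \<otimes> h = \<one>" using triv e by simp
    then have "h = h'" using G inv_solve_left'[of \<one> h' h] by simp
    then show "h = h' \<and> k = k'" using G eq by simp
  qed
  moreover have "H <#> K = (\<lambda>(h, k). h \<otimes> k) ` (H \<times> K)"
    by (auto simp: set_mult_def)
  ultimately show ?thesis by (simp add: card_image card_cartesian_product)
qed

text \<open>Split off the full power \<open>q\<close> of a prime \<open>p\<close> from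
  \<open>d\<close> and multiply the two subgroups. Since \<open>q\<close> is the
  \<open>p\<close>-part of \<open>d\<close> and not of the group order, the Sylow theorem is used in
  the form that allows \<open>p\<close> to divide the cofactor.\<close>

lemma (in comm_group) ex_subgroup_of_order:
  assumes "finite (carrier G)" "d dvd order G"
  shows "\<exists>H. subgroup H G \<and> card H = d"
  using assms(2)
proof (induction d rule: less_induct)
  case (less d)
  have d0: "d > 0" using less.prems assms(1) order_gt_0_iff_finite by (metis dvd_0_left_iff gr0I less_irrefl)
  show ?case
  proof (cases "d = 1")
    case True
    then show ?thesis using triv_subgroup by (intro exI[of _ "{\<one>}"]) auto
  next
    case False
    then obtain p where p: "Factorial_Ring.prime p" "p dvd d" using prime_factor_nat by blast
    obtain e where e: "d = p ^ multiplicity p d * e" "\<not> p dvd e"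
      using p d0 by (rule_tac multiplicity_decompose'[of d p]) auto
    define q where "q = p ^ multiplicity p d"
    have q: "d = q * e" using e q_def by simp
    have "multiplicity p d > 0" using p d0 by (simp add: prime_multiplicity_gt_zero_iff)
    then have "q > 1" using prime_gt_1_nat[OF p(1)] q_def by (simp add: one_less_power del: One_nat_def)
    moreover have "e > 0" using q d0 by (cases e) auto
    ultimately have "e < d" using q by simp
    moreover have "e dvd order G" "q dvd order G"
      using less.prems unfolding q by (rule dvd_mult_right dvd_mult_left)+
    ultimately obtain K where K: "subgroup K G" "card K = e" using less.IH by blast
    obtain m where "order G = q * m" using \<open>q dvd order G\<close> by blast
    then obtain H where H: "subgroup H G" "card H = q"
      using sylow_thm[OF p(1) is_group _ assms(1)] q_def by blast
    have "coprime q e" using e(2) p(1) q_def by (simp add: prime_imp_coprime)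
    then have "card (H <#> K) = d" using card_set_mult_coprime[OF assms(1) H(1) K(1)] H K q by simp
    then show ?thesis using mult_subgroups[OF H(1) K(1)] by blast
  qed
qed

text \<open>The prescribed value at 0 lets the neutral element be enumerated first. A line of the
  square on which an index is constantly 0 then contributes the product one.\<close>

lemma ex_bij_betw_lessThan:
  assumes "finite C" "c \<in> C"
  obtains e where "bij_betw e {..<card C} C" "e (0::nat) = c"
proof -
  obtain f where f: "bij_betw f {..<card C} C"
    using ex_bij_betw_nat_finite[OF assms(1)] by (auto simp: lessThan_atLeast0)
  then obtain k where k: "k < card C" "f k = c"
    using assms(2) by (metis bij_betw_def imageE lessThan_iff)
  have "bij_betw (f \<circ> transpose 0 k) {..<card C} C"
    by (rule bij_betw_trans[OF _ f]) (use k in \<open>auto intro!: bij_betw_byWitness[where f' = "transpose 0 k"] simp: transpose_def\<close>)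
  then show ?thesis using k by (intro that[of "f \<circ> transpose 0 k"]) auto
qed

lemma (in comm_monoid) finprod_lessThan_permute:
  fixes n :: nat
  assumes "f \<in> {..<n} \<rightarrow> carrier G" "inj_on p {..<n}" "p \<in> {..<n} \<rightarrow> {..<n}"
  shows "(\<Otimes>i\<in>{..<n}. f (p i)) = finprod G f {..<n}"
proof -
  have "p ` {..<n} = {..<n}" by (intro endo_inj_surj) (use assms in auto)
  with finprod_reindex[of f p "{..<n}"] assms show ?thesis by simp
qed

text \<open>The quotient has odd order, so the product of all cosets is \<open>H\<close> itself.
  Hence the product \<open>g\<close> of any representatives lies in \<open>H\<close>, and dividing
  one representative by \<open>g\<close> keeps its coset.\<close>

lemma (in comm_group) ex_coset_reps_finprod_one:
  assumes fin: "finite (carrier G)" and H: "subgroup H G" and n: "card (rcosets H) = n" "odd n" "n > 1"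
  obtains r where "bij_betw (\<lambda>u. H #> r u) {..<n} (rcosets H)" "r \<in> {..<n} \<rightarrow> carrier G"
    "r 0 = \<one>" "finprod G r {..<n} = \<one>"
proof -
  interpret H: subgroup H G by fact
  interpret normal H G using H by (simp add: normal_iff_subgroup)
  interpret Q: comm_group "G Mod H" using abelian_FactGroup H .
  have cQ: "carrier (G Mod H) = rcosets H" by (simp add: FactGroup_def)
  have fQ: "finite (rcosets H)" using n by (metis card.infinite not_less_zero)
  obtain e where e: "bij_betw e {..<n} (rcosets H)" "e 0 = H"
    using ex_bij_betw_lessThan[OF fQ H.subgroup_in_rcosets[OF is_group]] n by metis
  define \<rho> where "\<rho> u = (if u = 0 then \<one> else SOME x. x \<in> carrier G \<and> e u = H #> x)" for u :: nat
  have \<rho>: "\<rho> u \<in> carrier G \<and> H #> \<rho> u = e u" if "u < n" for u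
  proof (cases "u = 0")
    case False
    have "\<exists>x. x \<in> carrier G \<and> e u = H #> x"
      using bij_betwE[OF e(1)] that by (auto simp: RCOSETS_def)
    from someI_ex[OF this] show ?thesis using False by (simp add: \<rho>_def)
  qed (simp add: \<rho>_def e H.subset)
  define g where "g = finprod G \<rho> {..<n}"
  have gG: "g \<in> carrier G" unfolding g_def using \<rho> by auto
  have "H #> g = (\<Otimes>\<^bsub>G Mod H\<^esub>u\<in>{..<n}. H #> \<rho> u)"
    unfolding g_def by (rule hom_finprod[OF Q.comm_group_axioms r_coset_hom_Mod]) (use \<rho> in auto)
  also have "\<dots> = (\<Otimes>\<^bsub>G Mod H\<^esub>u\<in>{..<n}. e u)"
    by (rule Q.finprod_cong') (use \<rho> e in \<open>auto simp: cQ bij_betw_def\<close>)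
  also have "\<dots> = (\<Otimes>\<^bsub>G Mod H\<^esub>x\<in>e ` {..<n}. x)"
    by (rule Q.finprod_reindex[symmetric]) (use e in \<open>auto simp: cQ bij_betw_def\<close>)
  also have "e ` {..<n} = carrier (G Mod H)" using e by (simp add: cQ bij_betw_def)
  also have "finprod (G Mod H) (\<lambda>x. x) (carrier (G Mod H)) = H"
    using Q.finprod_carrier_odd n by (simp add: order_def cQ)
  finally have gH: "g \<in> H" using rcos_self[OF gG H] by simp
  \<comment> \<open>The correction is made at index 1, which exists because \<open>n > 1\<close>, so
    that the value at 0 stays \<open>\<one>\<close>.\<close>
  define r where "r = \<rho>(1 := \<rho> 1 \<otimes> inv g)"
  have r1: "H #> r 1 = H #> \<rho> 1"
  proof -
    have "r 1 = inv g \<otimes> \<rho> 1" using \<rho> gG n by (simp add: r_def m_comm)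
    then have "r 1 \<in> H #> \<rho> 1" using gH by (auto simp: r_coset_def)
    then show ?thesis using \<rho> n H by (metis repr_independence)
  qed
  have rG: "r \<in> {..<n} \<rightarrow> carrier G" using \<rho> gG n by (auto simp: r_def)
  have "bij_betw (\<lambda>u. H #> r u) {..<n} (rcosets H)"
  proof -
    have "H #> r u = e u" if "u < n" for u
      using r1 \<rho> that by (cases "u = 1") (auto simp: r_def)
    then show ?thesis using e(1) bij_betw_cong[of "{..<n}" "\<lambda>u. H #> r u" e] by simp
  qed
  moreover have "r 0 = \<one>" by (simp add: r_def \<rho>_def)
  moreover have "finprod G r {..<n} = \<one>"
  proof -
    have I: "{..<n} = insert 1 ({..<n} - {1})" using n by auto
    define z where "z = finprod G \<rho> ({..<n} - {1})"
    have z: "z \<in> carrier G" "\<rho> 1 \<in> carrier G" using \<rho> n by (auto simp: z_def)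
    have g: "g = \<rho> 1 \<otimes> z"
      unfolding g_def z_def by (subst I, subst finprod_insert) (use \<rho> n in auto)
    have "finprod G r {..<n} = r 1 \<otimes> finprod G r ({..<n} - {1})"
      by (subst I, subst finprod_insert) (use rG n in auto)
    also have "finprod G r ({..<n} - {1}) = z"
      unfolding z_def by (rule finprod_cong') (use \<rho> in \<open>auto simp: r_def\<close>)
    also have "r 1 \<otimes> z = (\<rho> 1 \<otimes> z) \<otimes> inv g"
      using z gG by (simp add: r_def m_ac)
    finally show ?thesis using gG by (simp only: g[symmetric] r_inv)
  qed
  ultimately show ?thesis using that rG by blast
qed

section \<open>Odd side length\<close>

lemma eq_if_int_dvd_diff:
  assumes "x < n" "y < n" "int n dvd int x - int y"
  shows "x = y"
  using assms by (metis mod_eq_dvd_iff mod_less nat_int of_nat_mod)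

lemma inj_on_add_mod: "inj_on (\<lambda>j. (a + j) mod n) {..<n::nat}"
proof (rule inj_onI)
  fix x y assume xy: "x \<in> {..<n}" "y \<in> {..<n}" "(a + x) mod n = (a + y) mod n"
  then have "int n dvd int x - int y"
    by (metis add_diff_cancel_left mod_eq_dvd_iff of_nat_add of_nat_mod)
  then show "x = y" using xy by (simp add: eq_if_int_dvd_diff)
qed

lemma (in comm_group) ex_magic_square_odd:
  assumes "order G = n\<^sup>2" "odd n" "n > 1"
  shows "\<exists>A. zero_sum_magic_square G n A"
proof -
  have fin: "finite (carrier G)"
    using assms(1,3) by (metis card.infinite less_nat_zero_code order_def power_eq_0_iff)
  obtain H where H: "subgroup H G" "card H = n"
    using ex_subgroup_of_order[OF fin, of n] assms(1) by (auto simp: power2_eq_square)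
  interpret H: subgroup H G by fact
  have rc: "card (rcosets H) = n"
    using lagrange[OF H(1)] H(2) assms by (simp add: power2_eq_square)
  obtain r where r: "bij_betw (\<lambda>u. H #> r u) {..<n} (rcosets H)" "r \<in> {..<n} \<rightarrow> carrier G"
    "r 0 = \<one>" "finprod G r {..<n} = \<one>"
    using ex_coset_reps_finprod_one[OF fin H(1) rc assms(2,3)] by metis
  obtain h where h: "bij_betw h {..<n} H" "h 0 = \<one>"
    using ex_bij_betw_lessThan[OF finite_subset[OF H.subset fin] H.one_closed] H(2) by metis
  have hH: "h \<in> {..<n} \<rightarrow> H" and hG: "h \<in> {..<n} \<rightarrow> carrier G"
    using bij_betwE[OF h(1)] by auto
  have ph: "finprod G h {..<n} = \<one>"
  proof -
    interpret HG: comm_group "G\<lparr>carrier := H\<rparr>" using H(1) by (rule subgroup_is_comm_group)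
    have "finprod G h {..<n} = finprod G (\<lambda>x. x) H"
      using finprod_reindex[of "\<lambda>x. x" h "{..<n}"] h(1) hG by (auto simp: bij_betw_def)
    also have "\<dots> = finprod (G\<lparr>carrier := H\<rparr>) (\<lambda>x. x) H"
      using finprod_subgroup[OF H(1), of "\<lambda>x. x" H] by simp
    also have "\<dots> = \<one>"
      using HG.finprod_carrier_odd H(2) assms(2) by (simp add: order_def)
    finally show ?thesis .
  qed
  \<comment> \<open>Along a row or column both indices run through all residues. On the main
    diagonal the second index is 0 and the first is 2 i + 1; on the antidiagonal the shift by 1
    makes the first index 0 and the second is 2 i + 1. Doubling permutes the residues as
    \<open>n\<close> is odd, and \<open>r 0\<close> and \<open>h 0\<close> are
    \<open>\<one>\<close>. The summand \<open>n\<close> avoids truncated subtraction.\<close>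
  define A where "A i j = r ((i + j + 1) mod n) \<otimes> h ((i + n - j) mod n)" for i j
  have prods: "(\<Otimes>i\<in>{..<n}. r (p i) \<otimes> h (q i)) = \<one>"
    if "(\<forall>i<n. p i = 0) \<or> inj_on p {..<n}" "(\<forall>i<n. q i = 0) \<or> inj_on q {..<n}"
      "\<And>i. i < n \<Longrightarrow> p i < n" "\<And>i. i < n \<Longrightarrow> q i < n" for p q
  proof -
    have "(\<Otimes>i\<in>{..<n}. r (p i)) = \<one>"
      using that(1)
    proof
      assume "inj_on p {..<n}"
      then show ?thesis using finprod_lessThan_permute[of r n p] r that by (auto simp: Pi_def)
    qed (auto intro!: finprod_one_eqI simp: r)
    moreover have "(\<Otimes>i\<in>{..<n}. h (q i)) = \<one>"
      using that(2)
    proof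
      assume "inj_on q {..<n}"
      then show ?thesis using finprod_lessThan_permute[of h n q] hG ph that by (auto simp: Pi_def)
    qed (auto intro!: finprod_one_eqI simp: h)
    ultimately show ?thesis
      using that r hG by (subst finprod_multf) (auto simp: Pi_def)
  qed
  have pos: "x mod n < n" for x using assms(3) by simp
  have inj1: "inj_on (\<lambda>j. (i + j + 1) mod n) {..<n}" for i
    using inj_on_add_mod[of "i + 1" n] by (simp add: add_ac)
  have inj2: "inj_on (\<lambda>i. (i + n - j) mod n) {..<n}" if "j < n" for j
    using inj_on_add_mod[of "n - j" n] that by (simp add: add_ac)
  have inj3: "inj_on (\<lambda>j. (i + n - j) mod n) {..<n}" for i
  proof (rule inj_onI)
    fix x y assume xy: "x \<in> {..<n}" "y \<in> {..<n}" "(i + n - x) mod n = (i + n - y) mod n"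
    then have "int n dvd int (i + n - x) - int (i + n - y)"
      by (metis mod_eq_dvd_iff of_nat_mod)
    also have "int (i + n - x) - int (i + n - y) = int y - int x" using xy by simp
    finally show "x = y" using xy eq_if_int_dvd_diff[of y n x] by simp
  qed
  have dbl: "x = y" if "x < n" "y < n" "int n dvd 2 * (int x - int y)" for x y
  proof -
    have "coprime (int n) 2" using assms(2) by simp
    then have "int n dvd int x - int y" using that(3) coprime_dvd_mult_right_iff by blast
    then show ?thesis using that by (simp add: eq_if_int_dvd_diff)
  qed
  have inj4: "inj_on (\<lambda>i. (i + i + 1) mod n) {..<n}"
  proof (rule inj_onI)
    fix x y assume xy: "x \<in> {..<n}" "y \<in> {..<n}" "(x + x + 1) mod n = (y + y + 1) mod n"
    then have "int n dvd int (x + x + 1) - int (y + y + 1)"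
      by (metis mod_eq_dvd_iff of_nat_mod)
    then show "x = y" using xy dbl[of x y] by (simp add: algebra_simps)
  qed
  have row: "(\<Otimes>j\<in>{..<n}. A i j) = \<one>" for i
    unfolding A_def by (rule prods) (use inj1[of i] inj3[of i] in \<open>auto simp: pos\<close>)
  have col: "(\<Otimes>i\<in>{..<n}. A i j) = \<one>" if "j < n" for j
    unfolding A_def by (rule prods) (use inj1[of j] that in \<open>auto simp: inj2 pos add.commute\<close>)
  have diag: "(\<Otimes>i\<in>{..<n}. A i i) = \<one>"
    unfolding A_def by (rule prods) (use inj4 in \<open>auto simp: pos\<close>)
  have anti: "(\<Otimes>i\<in>{..<n}. A i (n - 1 - i)) = \<one>"
  proof -
    have "inj_on (\<lambda>i. (i + n - (n - 1 - i)) mod n) {..<n}"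
      using inj4 by (rule inj_on_cong[THEN iffD1, rotated]) auto
    then show ?thesis unfolding A_def by (intro prods) (auto simp: pos)
  qed
  define \<phi> where "\<phi> = (\<lambda>(i, j). ((i + j + 1) mod n, (i + n - j) mod n))"
  have "inj_on \<phi> ({..<n} \<times> {..<n})"
  proof (rule inj_onI)
    fix x y assume xy: "x \<in> {..<n} \<times> {..<n}" "y \<in> {..<n} \<times> {..<n}" "\<phi> x = \<phi> y"
    obtain i j k l where ij: "x = (i, j)" "y = (k, l)" by (cases x, cases y)
    have lt: "i < n" "j < n" "k < n" "l < n" using xy ij by auto
    have "int n dvd int (i + j + 1) - int (k + l + 1)" "int n dvd int (i + n - j) - int (k + n - l)"
      using xy(3) ij unfolding mod_eq_dvd_iff[symmetric] of_nat_mod[symmetric]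
      by (simp_all only: \<phi>_def prod.case prod.inject)
    then have 1: "int n dvd int i + int j - int k - int l" "int n dvd int i - int j - int k + int l"
      using lt by (simp_all add: of_nat_diff algebra_simps)
    \<comment> \<open>Sum and difference of the two congruences isolate each coordinate up to a
      factor 2, which \<open>dbl\<close> cancels.\<close>
    then have "int n dvd (int i + int j - int k - int l) + (int i - int j - int k + int l)"
      "int n dvd (int i + int j - int k - int l) - (int i - int j - int k + int l)"
      by (blast intro: dvd_add dvd_diff)+
    then have "int n dvd 2 * (int i - int k)" "int n dvd 2 * (int j - int l)"
      by (simp_all add: algebra_simps)
    then show "x = y" using dbl lt ij by blast
  qed
  then have surj: "\<phi> ` ({..<n} \<times> {..<n}) = {..<n} \<times> {..<n}"
    by (intro endo_inj_surj) (auto simp: \<phi>_def pos)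
  have "(\<lambda>(i, j). A i j) ` ({..<n} \<times> {..<n}) = carrier G"
  proof
    show "(\<lambda>(i, j). A i j) ` ({..<n} \<times> {..<n}) \<subseteq> carrier G"
      using r(2) hG pos by (auto simp: A_def Pi_def)
    show "carrier G \<subseteq> (\<lambda>(i, j). A i j) ` ({..<n} \<times> {..<n})"
    proof
      fix g assume g: "g \<in> carrier G"
      then have "H #> g \<in> rcosets H" by (auto simp: RCOSETS_def)
      then obtain u where u: "u < n" "H #> g = H #> r u"
        using r(1) by (auto simp: bij_betw_def)
      have "g \<in> H #> r u" using rcos_self[OF g H(1)] u by simp
      then obtain x where x: "x \<in> H" "g = x \<otimes> r u" by (auto simp: r_coset_def)
      obtain w where w: "w < n" "x = h w" using x h(1) by (auto simp: bij_betw_def)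
      have "(u, w) \<in> \<phi> ` ({..<n} \<times> {..<n})" using surj u w by simp
      then obtain i j where ij: "i < n" "j < n" "(u, w) = \<phi> (i, j)" by auto
      then have "g = A i j" using x w u r(2) hG by (auto simp: A_def \<phi>_def Pi_def intro: m_comm)
      then show "g \<in> (\<lambda>(i, j). A i j) ` ({..<n} \<times> {..<n})" using ij by force
    qed
  qed
  moreover from this have "inj_on (\<lambda>(i, j). A i j) ({..<n} \<times> {..<n})"
    using assms(1) by (intro eq_card_imp_inj_on) (auto simp: order_def power2_eq_square)
  ultimately have "bij_betw (\<lambda>(i, j). A i j) ({..<n} \<times> {..<n}) (carrier G)"
    by (simp add: bij_betw_def)
  then show ?thesis
    using row col diag anti by (auto simp: zero_sum_magic_square_def magic_square_def)
qed

section \<open>The Klein four-subgroup\<close>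

lemma (in comm_group) klein_subgroup:
  assumes "a \<in> involutions G" "b \<in> involutions G" "a \<noteq> b"
  shows "subgroup {\<one>, a, b, a \<otimes> b} G" "card {\<one>, a, b, a \<otimes> b} = 4"
    and "a \<otimes> b \<noteq> \<one>" "a \<otimes> b \<noteq> a" "a \<otimes> b \<noteq> b"
proof -
  have G: "a \<in> carrier G" "b \<in> carrier G" "a \<otimes> a = \<one>" "b \<otimes> b = \<one>" "a \<noteq> \<one>" "b \<noteq> \<one>"
    using assms by (auto simp: involutions_def)
  have i: "inv a = a" "inv b = b" using G by (simp_all add: inv_equality)
  have m: "a \<otimes> (a \<otimes> b) = b" "b \<otimes> (a \<otimes> b) = a"
    using G m_assoc[of a a b] m_comm[of b "a \<otimes> b"] m_assoc[of a b b] by simp_all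
  show n: "a \<otimes> b \<noteq> \<one>" "a \<otimes> b \<noteq> a" "a \<otimes> b \<noteq> b"
    using G m assms(3) by (metis l_one r_one)+
  then show "card {\<one>, a, b, a \<otimes> b} = 4" using G assms(3) by auto
  show "subgroup {\<one>, a, b, a \<otimes> b} G"
    using G i m by (unfold_locales) (auto simp: inv_mult m_comm[of b a] m_comm[of "a \<otimes> b" a] m_comm[of "a \<otimes> b" b] m_assoc)
qed

section \<open>Side length twice an odd number\<close>

text \<open>
  Entry \<open>(k, l)\<close> is the arrangement \<open>[[1, r], [s, t]]\<close> of the Klein group in a two-by-two block,
  the elements being numbered 0 to 3. Every row of \<open>r\<close>, every column of \<open>s\<close> and both
  diagonals of \<open>t\<close> contain each of 1, 2, 3 once among the first three indices; the index 3 stands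
  for all further positions, of which there is an even number.
\<close>

definition klein_pattern :: "nat list list list" where
  "klein_pattern =
    [[[0,1,2,3],[0,2,1,3],[0,3,1,2],[0,2,1,3]],
     [[0,1,3,2],[0,2,3,1],[0,3,2,1],[0,3,2,1]],
     [[0,2,1,3],[0,3,2,1],[0,1,3,2],[0,1,3,2]],
     [[0,1,2,3],[0,2,3,1],[0,3,1,2],[0,1,2,3]]]"

text \<open>The three singled-out positions are the ends and the centre, so that the reflection i to
  m - 1 - i acts on classes: it swaps 0 and 2 and fixes 1 and 3. The antidiagonal can therefore be
  treated by classes as well.\<close>

definition position_class :: "nat \<Rightarrow> nat \<Rightarrow> nat" where
  "position_class m i = (if i = 0 then 0 else if i = m div 2 then 1 else if i = m - 1 then 2 else 3)"

lemma position_class_less: "position_class m i < 4"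
  by (simp add: position_class_def)

lemma position_class_reflect:
  assumes "odd m" "m > 1" "i < m"
  shows "position_class m (m - 1 - i) = [2, 1, 0, 3] ! position_class m i"
  using assms by (auto simp: position_class_def elim!: oddE)

text \<open>The classes 0, 1 and 2 occur once each. The other m - 3 positions are even in number, so
  an element of square one cancels there.\<close>

lemma (in comm_group) finprod_position_class:
  assumes m: "odd m" "m > 1" and f: "\<And>k. k < 4 \<Longrightarrow> f k \<in> carrier G"
    and one: "f 0 \<otimes> f 1 \<otimes> f 2 = \<one>" "f 3 \<otimes> f 3 = \<one>"
  shows "(\<Otimes>i\<in>{..<m}. f (position_class m i)) = \<one>"
proof -
  define p where "p = m div 2"
  have p: "m = 2 * p + 1" "p \<ge> 1" using m by (auto simp: p_def elim!: oddE)
  define R where "R = {..<m} - {0, p, 2 * p}"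
  have "card R = m - card {0, p, 2 * p}" using p by (subst R_def, subst card_Diff_subset) auto
  then have cR: "card R = 2 * (p - 1)" using p by (simp add: card_insert_if)
  have m_eq: "{..<m} = insert 0 (insert p (insert (2 * p) R))" using p by (auto simp: R_def)
  have "(\<Otimes>i\<in>R. f (position_class m i)) = (\<Otimes>i\<in>R. f 3)"
    by (rule finprod_cong') (use f p in \<open>auto simp: R_def position_class_def p_def[symmetric]\<close>)
  also have "\<dots> = f 3 [^] (2 * (p - 1))" using finprod_const[of "f 3" R] f cR by simp
  also have "\<dots> = (f 3 [^] (2::nat)) [^] (p - 1)" using f by (simp add: nat_pow_pow)
  also have "\<dots> = \<one>" using one f by (simp add: numeral_2_eq_2)
  finally have R: "(\<Otimes>i\<in>R. f (position_class m i)) = \<one>" .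
  have fG: "f (position_class m i) \<in> carrier G" for i using f position_class_less by blast
  have cl: "position_class m 0 = 0" "position_class m p = 1" "position_class m (2 * p) = 2"
    using p by (auto simp: position_class_def p_def[symmetric])
  have "(\<Otimes>i\<in>{..<m}. f (position_class m i))
    = f (position_class m 0) \<otimes> (f (position_class m p) \<otimes> (f (position_class m (2 * p)) \<otimes>
      (\<Otimes>i\<in>R. f (position_class m i))))"
    unfolding m_eq using p fG by (simp add: R_def)
  then show ?thesis using R cl one f by (simp add: m_assoc)
qed

text \<open>Every block runs through the whole Klein group, so the blocks together cover
  \<open>K <#> V\<close>.\<close>

lemma klein_pattern_surj:
  assumes "k < 4" "l < 4" "e < 4"
  obtains \<alpha> \<beta> where "\<alpha> < 2" "\<beta> < 2" "klein_pattern ! k ! l ! (2 * \<alpha> + \<beta>) = e"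
proof -
  have "\<forall>k\<in>{..<4}. \<forall>l\<in>{..<4}. \<forall>e\<in>{..<4}. \<exists>\<alpha>\<in>{..<2}. \<exists>\<beta>\<in>{..<2}. klein_pattern ! k ! l ! (2 * \<alpha> + \<beta>) = e"
    by code_simp
  then have "\<exists>\<alpha>\<in>{..<2}. \<exists>\<beta>\<in>{..<2}. klein_pattern ! k ! l ! (2 * \<alpha> + \<beta>) = e"
    using assms by (blast intro: lessThan_iff[THEN iffD2])
  then show ?thesis using that by blast
qed

lemma klein_pattern_less:
  assumes "k < 4" "l < 4" "x < 4"
  shows "klein_pattern ! k ! l ! x < 4"
proof -
  have "\<forall>k\<in>{..<4}. \<forall>l\<in>{..<4}. \<forall>x\<in>{..<4}. klein_pattern ! k ! l ! x < 4"
    by code_simp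
  then show ?thesis using assms by (blast intro: lessThan_iff[THEN iffD2])
qed

lemma (in comm_group) ex_magic_square_twice_odd:
  assumes n: "order G = (2 * m)\<^sup>2" "odd m" "m > 1" and inv: "card (involutions G) > 1"
  shows "\<exists>A. zero_sum_magic_square G (2 * m) A"
proof -
  have fin: "finite (carrier G)"
    using n order_gt_0_iff_finite by (metis mult_pos_pos order.strict_trans pos2 zero_less_one zero_less_power)
  obtain a b where ab: "a \<in> involutions G" "b \<in> involutions G" "a \<noteq> b"
    using inv by (metis One_nat_def card_le_Suc0_iff_eq card.infinite not_less not_less_zero)
  define c where "c = a \<otimes> b"
  define V where "V = {\<one>, a, b, c}"
  have V: "subgroup V G" "card V = 4" using klein_subgroup[OF ab] by (simp_all add: V_def c_def)
  have abG: "a \<in> carrier G" "b \<in> carrier G" "c \<in> carrier G" "a \<otimes> a = \<one>" "b \<otimes> b = \<one>"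
    using ab by (auto simp: involutions_def c_def)
  have tab: "a \<otimes> b = c" "b \<otimes> a = c" "a \<otimes> c = b" "c \<otimes> a = b" "b \<otimes> c = a" "c \<otimes> b = a" "c \<otimes> c = \<one>"
  proof -
    show "a \<otimes> b = c" "b \<otimes> a = c" using abG by (simp_all add: c_def m_comm)
    show 1: "a \<otimes> c = b" using abG m_assoc[of a a b] by (simp add: c_def)
    show 2: "c \<otimes> b = a" using abG m_assoc[of a b b] by (simp add: c_def)
    show "c \<otimes> a = b" "b \<otimes> c = a" using 1 2 abG by (simp_all add: m_comm)
    then show "c \<otimes> c = \<one>" using abG m_assoc[of c a b] by (simp add: c_def[symmetric])
  qed
  have "m\<^sup>2 dvd order G" using n by (simp add: power_mult_distrib)
  then obtain K where K: "subgroup K G" "card K = m\<^sup>2" using ex_subgroup_of_order[OF fin] by blast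
  interpret K: subgroup K G by fact
  interpret KG: comm_group "G\<lparr>carrier := K\<rparr>" using K(1) by (rule subgroup_is_comm_group)
  obtain M where M: "zero_sum_magic_square (G\<lparr>carrier := K\<rparr>) m M"
    using KG.ex_magic_square_odd n K by (auto simp: order_def)
  have MK: "M i j \<in> K" if "i < m" "j < m" for i j
    using M that unfolding zero_sum_magic_square_def magic_square_def by (auto dest!: bij_betwE)
  have MG: "M i j \<in> carrier G" if "i < m" "j < m" for i j using MK[OF that] by simp
  have Msurj: "\<exists>i<m. \<exists>j<m. M i j = x" if "x \<in> K" for x
    using M that unfolding zero_sum_magic_square_def magic_square_def bij_betw_def by force
  have Mrow: "(\<Otimes>j\<in>{..<m}. M i j) = \<one>" if "i < m" for i
    using M that finprod_subgroup[OF K(1), of "\<lambda>j. M i j" "{..<m}"] MK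
    unfolding zero_sum_magic_square_def magic_square_def by auto
  have Mcol: "(\<Otimes>i\<in>{..<m}. M i j) = \<one>" if "j < m" for j
    using M that finprod_subgroup[OF K(1), of "\<lambda>i. M i j" "{..<m}"] MK
    unfolding zero_sum_magic_square_def magic_square_def by auto
  have Mdiag: "(\<Otimes>i\<in>{..<m}. M i i) = \<one>"
    using M finprod_subgroup[OF K(1), of "\<lambda>i. M i i" "{..<m}"] MK
    unfolding zero_sum_magic_square_def magic_square_def by auto
  have Manti: "(\<Otimes>i\<in>{..<m}. M i (m - 1 - i)) = \<one>"
    using M finprod_subgroup[OF K(1), of "\<lambda>i. M i (m - 1 - i)" "{..<m}"] MK
    unfolding zero_sum_magic_square_def magic_square_def by auto
  define w where "w k l \<alpha> \<beta> = [\<one>, a, b, c] ! (klein_pattern ! k ! l ! (2 * \<alpha> + \<beta>))" for k l \<alpha> \<beta>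
  have wG: "w k l \<alpha> \<beta> \<in> carrier G" if "k < 4" "l < 4" "\<alpha> < 2" "\<beta> < 2" for k l \<alpha> \<beta>
  proof -
    have "[\<one>, a, b, c] ! x \<in> carrier G" if "x < 4" for x
      using that abG by (auto simp: less_Suc_eq numeral_eq_Suc)
    then show ?thesis using klein_pattern_less[of k l "2 * \<alpha> + \<beta>"] that by (simp add: w_def)
  qed
  define A where "A i j = M (i div 2) (j div 2) \<otimes>
    w (position_class m (i div 2)) (position_class m (j div 2)) (i mod 2) (j mod 2)" for i j
  have AG: "A i j \<in> carrier G" if "i < 2 * m" "j < 2 * m" for i j
    unfolding A_def using that by (intro m_closed MG wG position_class_less) auto
  \<comment> \<open>Shared by rows, columns and both diagonals. Such a line meets two cells of each
    of m blocks, both carrying the entry \<open>Y q\<close> of the small square, so the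
    \<open>Y\<close> part is the square of a product equal to one. In a block [[1, r], [s, t]] the
    Klein factors multiply to r along either row, to s along either column and to t along either
    diagonal, since r, s, t are the three nontrivial elements. Three different ones have product
    one.\<close>
  have prods: "finprod G F {..<2 * m} = \<one>"
    if F: "\<And>q. q < m \<Longrightarrow> F (2 * q) = Y q \<otimes> u (position_class m q) \<and> F (2 * q + 1) = Y q \<otimes> v (position_class m q)"
      and Y: "(\<Otimes>q\<in>{..<m}. Y q) = \<one>" "\<And>q. q < m \<Longrightarrow> Y q \<in> carrier G"
      and u: "\<And>k. k < 4 \<Longrightarrow> u k \<in> carrier G \<and> v k \<in> carrier G"
      and one: "(u 0 \<otimes> v 0) \<otimes> (u 1 \<otimes> v 1) \<otimes> (u 2 \<otimes> v 2) = \<one>" "(u 3 \<otimes> v 3) \<otimes> (u 3 \<otimes> v 3) = \<one>"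
      and FG: "F \<in> {..<2 * m} \<rightarrow> carrier G" for F Y u v
  proof -
    have uG: "u (position_class m q) \<in> carrier G" "v (position_class m q) \<in> carrier G" for q
      using u position_class_less by blast+
    have "finprod G F {..<2 * m} = (\<Otimes>q\<in>{..<m}. F (2 * q) \<otimes> F (2 * q + 1))"
      by (rule finprod_lessThan_pairs) fact
    also have "\<dots> = (\<Otimes>q\<in>{..<m}. (Y q \<otimes> Y q) \<otimes> (u (position_class m q) \<otimes> v (position_class m q)))"
      by (rule finprod_cong') (use F Y uG in \<open>auto simp: m_ac\<close>)
    also have "\<dots> = (\<Otimes>q\<in>{..<m}. u (position_class m q) \<otimes> v (position_class m q))"
      using Y uG by (simp add: Pi_def)
    also have "\<dots> = \<one>"
      by (rule finprod_position_class[where f = "\<lambda>k. u k \<otimes> v k"]) (use n u one in auto)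
    finally show ?thesis .
  qed
  note ev = w_def klein_pattern_def tab abG
  have less4: "k < 4 \<longleftrightarrow> k = 0 \<or> k = 1 \<or> k = 2 \<or> k = 3" for k :: nat by auto
  have less2: "k < 2 \<longleftrightarrow> k = 0 \<or> k = 1" for k :: nat by auto
  have wrow: "(w k 0 \<alpha> 0 \<otimes> w k 0 \<alpha> 1) \<otimes> (w k 1 \<alpha> 0 \<otimes> w k 1 \<alpha> 1) \<otimes> (w k 2 \<alpha> 0 \<otimes> w k 2 \<alpha> 1) = \<one>"
      "(w k 3 \<alpha> 0 \<otimes> w k 3 \<alpha> 1) \<otimes> (w k 3 \<alpha> 0 \<otimes> w k 3 \<alpha> 1) = \<one>"
    and wcol: "(w 0 k 0 \<alpha> \<otimes> w 0 k 1 \<alpha>) \<otimes> (w 1 k 0 \<alpha> \<otimes> w 1 k 1 \<alpha>) \<otimes> (w 2 k 0 \<alpha> \<otimes> w 2 k 1 \<alpha>) = \<one>"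
      "(w 3 k 0 \<alpha> \<otimes> w 3 k 1 \<alpha>) \<otimes> (w 3 k 0 \<alpha> \<otimes> w 3 k 1 \<alpha>) = \<one>"
    if "k < 4" "\<alpha> < 2" for k \<alpha>
    using that unfolding less4 less2 by (elim disjE; simp add: ev)+
  have row: "(\<Otimes>j\<in>{..<2 * m}. A i j) = \<one>" if i: "i < 2 * m" for i
  proof -
    have k: "position_class m (i div 2) < 4" "i mod 2 < 2" by (simp_all add: position_class_less)
    show ?thesis
      by (rule prods[where Y = "\<lambda>q. M (i div 2) q" and u = "\<lambda>l. w (position_class m (i div 2)) l (i mod 2) 0"
              and v = "\<lambda>l. w (position_class m (i div 2)) l (i mod 2) 1"])
        (use i k in \<open>simp_all add: Mrow MG wG AG wrow[unfolded One_nat_def] Pi_def A_def[of i "2 * _"] A_def[of i "Suc (2 * _)"]\<close>)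
  qed
  have col: "(\<Otimes>i\<in>{..<2 * m}. A i j) = \<one>" if j: "j < 2 * m" for j
  proof -
    have k: "position_class m (j div 2) < 4" "j mod 2 < 2" by (simp_all add: position_class_less)
    show ?thesis
      by (rule prods[where Y = "\<lambda>q. M q (j div 2)" and u = "\<lambda>l. w l (position_class m (j div 2)) 0 (j mod 2)"
              and v = "\<lambda>l. w l (position_class m (j div 2)) 1 (j mod 2)"])
        (use j k in \<open>simp_all add: Mcol MG wG AG wcol[unfolded One_nat_def] Pi_def A_def[of "2 * _" j] A_def[of "Suc (2 * _)" j]\<close>)
  qed
  have diag: "(\<Otimes>i\<in>{..<2 * m}. A i i) = \<one>"
    by (rule prods[where Y = "\<lambda>q. M q q" and u = "\<lambda>l. w l l 0 0" and v = "\<lambda>l. w l l 1 1"])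
      (simp_all add: Mdiag MG wG AG Pi_def A_def[of "2 * _"] A_def[of "Suc (2 * _)"], simp_all add: ev)
  \<comment> \<open>The antidiagonal meets block row q in block column m - 1 - q, at the cells (0,
    1) and (1, 0). The list \<open>[2, 1, 0, 3]\<close> is the action of the reflection on position
    classes.\<close>
  have anti: "(\<Otimes>i\<in>{..<2 * m}. A i (2 * m - 1 - i)) = \<one>"
  proof (rule prods[where Y = "\<lambda>q. M q (m - 1 - q)" and u = "\<lambda>l. w l ([2, 1, 0, 3] ! l) 0 1"
              and v = "\<lambda>l. w l ([2, 1, 0, 3] ! l) 1 0"])
    fix q assume q: "q < m"
    have "2 * m - 1 - 2 * q = 2 * (m - 1 - q) + 1" "2 * m - 1 - (2 * q + 1) = 2 * (m - 1 - q)"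
      using q by auto
    then show "A (2 * q) (2 * m - 1 - 2 * q) = M q (m - 1 - q) \<otimes> w (position_class m q) ([2, 1, 0, 3] ! position_class m q) 0 1 \<and>
         A (2 * q + 1) (2 * m - 1 - (2 * q + 1)) = M q (m - 1 - q) \<otimes> w (position_class m q) ([2, 1, 0, 3] ! position_class m q) 1 0"
      using position_class_reflect[OF n(2,3) q] by (simp add: A_def)
  next
    fix k :: nat assume "k < 4"
    then have "[2, 1, 0, 3] ! k < (4::nat)" unfolding less4 by auto
    then show "w k ([2, 1, 0, 3] ! k) 0 1 \<in> carrier G \<and> w k ([2, 1, 0, 3] ! k) 1 0 \<in> carrier G"
      using \<open>k < 4\<close> by (simp add: wG)
  next
    show "(\<lambda>i. A i (2 * m - 1 - i)) \<in> {..<2 * m} \<rightarrow> carrier G" by (auto intro!: AG)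
  next
    show "M q (m - 1 - q) \<in> carrier G" if "q < m" for q using that by (auto intro!: MG)
  qed (use Manti in \<open>simp_all add: ev\<close>)
  \<comment> \<open>Oddness of \<open>m\<close> makes the orders of \<open>K\<close> and
    \<open>V\<close> coprime, so \<open>K <#> V\<close> has order 4 m^2 and is the whole
    group.\<close>
  have "coprime m (2\<^sup>2)" using n by (simp only: coprime_power_right_iff coprime_right_2_iff_odd) simp
  then have "coprime (card K) (card V)" using K V by simp
  then have "card (K <#> V) = order G"
    using card_set_mult_coprime[OF fin K(1) V(1)] K V n by (simp add: power_mult_distrib)
  then have KV: "K <#> V = carrier G"
    using fin subgroup.subset[OF mult_subgroups[OF K(1) V(1)]] by (simp add: card_subset_eq order_def)
  have "(\<lambda>(i, j). A i j) ` ({..<2 * m} \<times> {..<2 * m}) = carrier G"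
  proof
    show "(\<lambda>(i, j). A i j) ` ({..<2 * m} \<times> {..<2 * m}) \<subseteq> carrier G"
      using AG by auto
    show "carrier G \<subseteq> (\<lambda>(i, j). A i j) ` ({..<2 * m} \<times> {..<2 * m})"
    proof
      fix g assume "g \<in> carrier G"
      then have "g \<in> K <#> V" using KV by simp
      then obtain x v where xv: "x \<in> K" "v \<in> V" "g = x \<otimes> v" by (auto simp: set_mult_def)
      obtain p q where pq: "p < m" "q < m" "M p q = x" using Msurj xv by blast
      have "\<exists>e<4. [\<one>, a, b, c] ! e = v"
        using xv(2) unfolding V_def by (auto simp: less4 ev)
      then obtain e where e: "e < 4" "[\<one>, a, b, c] ! e = v" by blast
      obtain \<alpha> \<beta> where \<alpha>: "\<alpha> < 2" "\<beta> < 2"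
        "klein_pattern ! position_class m p ! position_class m q ! (2 * \<alpha> + \<beta>) = e"
        using klein_pattern_surj[OF position_class_less position_class_less e(1)] by metis
      have "A (2 * p + \<alpha>) (2 * q + \<beta>) = g" using \<alpha> e pq xv by (simp add: A_def w_def)
      then show "g \<in> (\<lambda>(i, j). A i j) ` ({..<2 * m} \<times> {..<2 * m})"
        using pq \<alpha> by (intro image_eqI[of _ _ "(2 * p + \<alpha>, 2 * q + \<beta>)"]) auto
    qed
  qed
  moreover from this have "inj_on (\<lambda>(i, j). A i j) ({..<2 * m} \<times> {..<2 * m})"
    using n(1) by (intro eq_card_imp_inj_on) (auto simp: order_def power2_eq_square)
  ultimately have "bij_betw (\<lambda>(i, j). A i j) ({..<2 * m} \<times> {..<2 * m}) (carrier G)"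
    by (simp add: bij_betw_def)
  then show ?thesis
    using row col diag anti by (auto simp: zero_sum_magic_square_def magic_square_def)
qed

section \<open>Folding four-by-four tiles into a square\<close>

text \<open>The bracketing in pairs matches the division of a tile into two-by-two blocks. Entries
  may repeat here; distinctness comes from the final count.\<close>

definition zero_tile :: "('a, 'b) monoid_scheme \<Rightarrow> (nat \<Rightarrow> nat \<Rightarrow> 'a) \<Rightarrow> bool" where
  "zero_tile G T \<longleftrightarrow>
     (\<forall>i<4. \<forall>j<4. T i j \<in> carrier G) \<and>
     (\<forall>i<4. (T i 0 \<otimes>\<^bsub>G\<^esub> T i 1) \<otimes>\<^bsub>G\<^esub> (T i 2 \<otimes>\<^bsub>G\<^esub> T i 3) = \<one>\<^bsub>G\<^esub>) \<and>
     (\<forall>j<4. (T 0 j \<otimes>\<^bsub>G\<^esub> T 1 j) \<otimes>\<^bsub>G\<^esub> (T 2 j \<otimes>\<^bsub>G\<^esub> T 3 j) = \<one>\<^bsub>G\<^esub>) \<and>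
     (T 0 0 \<otimes>\<^bsub>G\<^esub> T 1 1) \<otimes>\<^bsub>G\<^esub> (T 2 2 \<otimes>\<^bsub>G\<^esub> T 3 3) = \<one>\<^bsub>G\<^esub> \<and>
     (T 0 3 \<otimes>\<^bsub>G\<^esub> T 1 2) \<otimes>\<^bsub>G\<^esub> (T 2 1 \<otimes>\<^bsub>G\<^esub> T 3 0) = \<one>\<^bsub>G\<^esub>"

definition tile_cells :: "(nat \<Rightarrow> nat \<Rightarrow> 'a) \<Rightarrow> 'a set" where
  "tile_cells T = (\<lambda>(i, j). T i j) ` ({..<4} \<times> {..<4})"

lemma less_4_iff: "k < 4 \<longleftrightarrow> k = 0 \<or> k = 1 \<or> k = 2 \<or> k = (3::nat)"
  by auto

lemma tile_cells_list:
  "tile_cells (\<lambda>i j. [[t00,t01,t02,t03],[t10,t11,t12,t13],[t20,t21,t22,t23],[t30,t31,t32,t33]] ! i ! j)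
    = {t00,t01,t02,t03,t10,t11,t12,t13,t20,t21,t22,t23,t30,t31,t32,t33}"
proof -
  have "{..<4} = {0, 1, 2, 3::nat}" by auto
  then show ?thesis unfolding tile_cells_def by (simp add: insert_commute)
qed

lemma zero_tile_list:
  fixes G (structure)
  assumes "{t00,t01,t02,t03,t10,t11,t12,t13,t20,t21,t22,t23,t30,t31,t32,t33} \<subseteq> carrier G"
    and "(t00 \<otimes> t01) \<otimes> (t02 \<otimes> t03) = \<one>" "(t10 \<otimes> t11) \<otimes> (t12 \<otimes> t13) = \<one>"
    and "(t20 \<otimes> t21) \<otimes> (t22 \<otimes> t23) = \<one>" "(t30 \<otimes> t31) \<otimes> (t32 \<otimes> t33) = \<one>"
    and "(t00 \<otimes> t10) \<otimes> (t20 \<otimes> t30) = \<one>" "(t01 \<otimes> t11) \<otimes> (t21 \<otimes> t31) = \<one>"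
    and "(t02 \<otimes> t12) \<otimes> (t22 \<otimes> t32) = \<one>" "(t03 \<otimes> t13) \<otimes> (t23 \<otimes> t33) = \<one>"
    and "(t00 \<otimes> t11) \<otimes> (t22 \<otimes> t33) = \<one>" "(t03 \<otimes> t12) \<otimes> (t21 \<otimes> t30) = \<one>"
  shows "zero_tile G (\<lambda>i j. [[t00,t01,t02,t03],[t10,t11,t12,t13],[t20,t21,t22,t23],[t30,t31,t32,t33]] ! i ! j)"
proof -
  have all4: "(\<forall>i<4. P i) \<longleftrightarrow> P 0 \<and> P 1 \<and> P 2 \<and> P 3" for P :: "nat \<Rightarrow> bool"
    unfolding less_4_iff by auto
  show ?thesis using assms unfolding zero_tile_def all4 by simp
qed

text \<open>On each axis the tile with index p takes two neighbouring positions and their two mirror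
  images, in increasing order.\<close>

definition fold_pos :: "nat \<Rightarrow> nat \<Rightarrow> nat \<Rightarrow> nat" where
  "fold_pos k p a = [2 * p, 2 * p + 1, 4 * k - 1 - (2 * p + 1), 4 * k - 1 - 2 * p] ! a"

text \<open>Together with \<open>fold_cell\<close> this inverts \<open>fold_pos\<close>: it recovers
  the tile, \<open>fold_cell\<close> the position inside it.\<close>

definition fold_tile :: "nat \<Rightarrow> nat \<Rightarrow> nat" where
  "fold_tile k i = (if i < 2 * k then i else 4 * k - 1 - i) div 2"

definition fold_cell :: "nat \<Rightarrow> nat \<Rightarrow> nat" where
  "fold_cell k i = (if i < 2 * k then i mod 2 else 3 - (4 * k - 1 - i) mod 2)"

text \<open>The last equation is the point of the folding: reflecting an axis reverses each tile in
  place. The antidiagonal of the square thus meets exactly the tiles (q, q), each in its own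
  antidiagonal.\<close>

lemma fold_pos:
  assumes "p < k" "a < 4"
  shows "fold_pos k p a < 4 * k" "fold_tile k (fold_pos k p a) = p" "fold_cell k (fold_pos k p a) = a"
    "4 * k - 1 - fold_pos k p a = fold_pos k p (3 - a)"
  using assms unfolding less_4_iff fold_pos_def fold_tile_def fold_cell_def
  by (elim disjE; simp; presburger)+

lemma fold_less:
  assumes "i < 4 * k"
  shows "fold_tile k i < k" "fold_cell k i < 4"
  using assms by (auto simp: fold_tile_def fold_cell_def)

lemma (in comm_group) finprod_fold_pos:
  assumes F: "F \<in> {..<4 * k} \<rightarrow> carrier G"
    and one: "\<And>q. q < k \<Longrightarrow> (F (fold_pos k q 0) \<otimes> F (fold_pos k q 1)) \<otimes> (F (fold_pos k q 2) \<otimes> F (fold_pos k q 3)) = \<one>"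
  shows "finprod G F {..<4 * k} = \<one>"
proof -
  have FG: "F i \<in> carrier G" if "i < 4 * k" for i using F that by auto
  have "finprod G F {..<2 * (2 * k)} = (\<Otimes>i\<in>{..<2 * k}. F i \<otimes> F (2 * (2 * k) - 1 - i))"
    by (rule finprod_lessThan_folded) (use F in auto)
  also have "\<dots> = (\<Otimes>q\<in>{..<k}. (F (2 * q) \<otimes> F (2 * (2 * k) - 1 - 2 * q)) \<otimes>
      (F (2 * q + 1) \<otimes> F (2 * (2 * k) - 1 - (2 * q + 1))))"
    by (rule finprod_lessThan_pairs) (auto intro!: FG)
  also have "\<dots> = \<one>"
  proof (rule finprod_one_eqI)
    fix q assume "q \<in> {..<k}"
    then have q: "q < k" by simp
    have G: "F (fold_pos k q a) \<in> carrier G" if "a < 4" for a using FG fold_pos(1)[OF q that] .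
    have "(F (2 * q) \<otimes> F (2 * (2 * k) - 1 - 2 * q)) \<otimes> (F (2 * q + 1) \<otimes> F (2 * (2 * k) - 1 - (2 * q + 1)))
      = (F (fold_pos k q 0) \<otimes> F (fold_pos k q 3)) \<otimes> (F (fold_pos k q 1) \<otimes> F (fold_pos k q 2))"
      by (simp add: fold_pos_def)
    also have "\<dots> = (F (fold_pos k q 0) \<otimes> F (fold_pos k q 1)) \<otimes> (F (fold_pos k q 2) \<otimes> F (fold_pos k q 3))"
      using G[of 0] G[of 1] G[of 2] G[of 3] by (simp add: m_ac)
    finally show "(F (2 * q) \<otimes> F (2 * (2 * k) - 1 - 2 * q)) \<otimes>
        (F (2 * q + 1) \<otimes> F (2 * (2 * k) - 1 - (2 * q + 1))) = \<one>" using one[OF q] by simp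
  qed
  finally show ?thesis by simp
qed

lemma (in comm_group) ex_magic_square_of_tiles:
  assumes n: "order G = (4 * k)\<^sup>2" and T: "\<And>t. t < k * k \<Longrightarrow> zero_tile G (T t)"
    and cover: "carrier G \<subseteq> (\<Union>t<k * k. tile_cells (T t))"
  shows "\<exists>A. zero_sum_magic_square G (4 * k) A"
proof -
  define A where "A i j = T (fold_tile k i * k + fold_tile k j) (fold_cell k i) (fold_cell k j)" for i j
  have less: "p * k + q < k * k" if "p < k" "q < k" for p q
  proof -
    have "p * k + q < p * k + k" using that by simp
    also have "\<dots> = Suc p * k" by simp
    also have "\<dots> \<le> k * k" using that by (intro mult_le_mono1) simp
    finally show ?thesis .
  qed
  have AG: "A i j \<in> carrier G" if "i < 4 * k" "j < 4 * k" for i j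
    using T[OF less[OF fold_less(1)[OF that(1)] fold_less(1)[OF that(2)]]] fold_less(2) that
    by (simp add: A_def zero_tile_def)
  have row: "(\<Otimes>j\<in>{..<4 * k}. A i j) = \<one>" if i: "i < 4 * k" for i
  proof (rule finprod_fold_pos)
    fix q assume q: "q < k"
    have "zero_tile G (T (fold_tile k i * k + q))" using T less fold_less i q by simp
    then show "(A i (fold_pos k q 0) \<otimes> A i (fold_pos k q 1)) \<otimes> (A i (fold_pos k q 2) \<otimes> A i (fold_pos k q 3)) = \<one>"
      using fold_less(2)[OF i] q by (simp add: A_def fold_pos zero_tile_def)
  qed (use AG i in auto)
  have col: "(\<Otimes>i\<in>{..<4 * k}. A i j) = \<one>" if j: "j < 4 * k" for j
  proof (rule finprod_fold_pos)
    fix q assume q: "q < k"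
    have "zero_tile G (T (q * k + fold_tile k j))" using T less fold_less j q by simp
    then show "(A (fold_pos k q 0) j \<otimes> A (fold_pos k q 1) j) \<otimes> (A (fold_pos k q 2) j \<otimes> A (fold_pos k q 3) j) = \<one>"
      using fold_less(2)[OF j] q by (simp add: A_def fold_pos zero_tile_def)
  qed (use AG j in auto)
  have diag: "(\<Otimes>i\<in>{..<4 * k}. A i i) = \<one>"
  proof (rule finprod_fold_pos)
    fix q assume q: "q < k"
    have "zero_tile G (T (q * k + q))" using T less q by simp
    then show "(A (fold_pos k q 0) (fold_pos k q 0) \<otimes> A (fold_pos k q 1) (fold_pos k q 1)) \<otimes>
        (A (fold_pos k q 2) (fold_pos k q 2) \<otimes> A (fold_pos k q 3) (fold_pos k q 3)) = \<one>"
      using q by (simp add: A_def fold_pos zero_tile_def)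
  qed (use AG in auto)
  have anti: "(\<Otimes>i\<in>{..<4 * k}. A i (4 * k - 1 - i)) = \<one>"
  proof (rule finprod_fold_pos)
    fix q assume q: "q < k"
    have "zero_tile G (T (q * k + q))" using T less q by simp
    then show "(A (fold_pos k q 0) (4 * k - 1 - fold_pos k q 0) \<otimes> A (fold_pos k q 1) (4 * k - 1 - fold_pos k q 1)) \<otimes>
        (A (fold_pos k q 2) (4 * k - 1 - fold_pos k q 2) \<otimes> A (fold_pos k q 3) (4 * k - 1 - fold_pos k q 3)) = \<one>"
      unfolding A_def
      using q fold_pos(4)[OF q, of 0] fold_pos(4)[OF q, of 1] fold_pos(4)[OF q, of 2] fold_pos(4)[OF q, of 3]
      by (simp add: fold_pos zero_tile_def)
  qed (auto intro!: AG)
  have "(\<lambda>(i, j). A i j) ` ({..<4 * k} \<times> {..<4 * k}) = carrier G"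
  proof
    show "(\<lambda>(i, j). A i j) ` ({..<4 * k} \<times> {..<4 * k}) \<subseteq> carrier G"
      using AG by auto
    show "carrier G \<subseteq> (\<lambda>(i, j). A i j) ` ({..<4 * k} \<times> {..<4 * k})"
    proof
      fix g assume "g \<in> carrier G"
      then obtain t where t: "t < k * k" "g \<in> tile_cells (T t)" using cover by blast
      then obtain a b where ab: "a < 4" "b < 4" "g = T t a b" by (auto simp: tile_cells_def)
      have k: "k > 0" using t by (cases k) auto
      have pq: "t div k < k" "t mod k < k" using t k by (auto simp: less_mult_imp_div_less)
      have "g = A (fold_pos k (t div k) a) (fold_pos k (t mod k) b)"
        using ab pq by (simp add: A_def fold_pos)
      then show "g \<in> (\<lambda>(i, j). A i j) ` ({..<4 * k} \<times> {..<4 * k})"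
        using fold_pos(1)[OF pq(1) ab(1)] fold_pos(1)[OF pq(2) ab(2)]
        by (intro image_eqI[of _ _ "(fold_pos k (t div k) a, fold_pos k (t mod k) b)"]) auto
    qed
  qed
  moreover from this have "inj_on (\<lambda>(i, j). A i j) ({..<4 * k} \<times> {..<4 * k})"
    using n by (intro eq_card_imp_inj_on) (auto simp: order_def power2_eq_square)
  ultimately have "bij_betw (\<lambda>(i, j). A i j) ({..<4 * k} \<times> {..<4 * k}) (carrier G)"
    by (simp add: bij_betw_def)
  then show ?thesis
    using row col diag anti by (auto simp: zero_sum_magic_square_def magic_square_def)
qed

section \<open>Dominoes of cosets of a Klein four-subgroup\<close>

locale klein = comm_group G for G (structure) +
  fixes V
  assumes finite_carrier: "finite (carrier G)"
    and subgroup_V: "subgroup V G"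
    and card_V: "card V = 4"
    and square_V: "v \<in> V \<Longrightarrow> v \<otimes> v = \<one>"
begin

sublocale V: subgroup V G by (rule subgroup_V)

lemma finite_V: "finite V"
  using card_V by (metis card.infinite zero_neq_numeral)

lemma V_cancel: "v \<in> V \<Longrightarrow> z \<in> carrier G \<Longrightarrow> v \<otimes> (v \<otimes> z) = z"
  using square_V m_assoc[of v v z] by simp

lemma mult_eq_one_V:
  assumes "v \<in> V" "w \<in> V"
  shows "v \<otimes> w = \<one> \<longleftrightarrow> v = w"
proof
  assume "v \<otimes> w = \<one>"
  then show "v = w" using V_cancel[OF assms(1), of w] assms by simp
qed (use square_V assms in simp)

lemma V_eq:
  assumes "t \<in> V" "w \<in> V" "t \<noteq> \<one>" "w \<noteq> \<one>" "t \<noteq> w"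
  shows "V = {\<one>, t, w, t \<otimes> w}"
proof -
  have "t \<otimes> w \<noteq> \<one>" using assms mult_eq_one_V by simp
  moreover have "t \<otimes> w \<noteq> t" using V_cancel[of t w] square_V[of t] assms by force
  moreover have "t \<otimes> w \<noteq> w" using V_cancel[of w t] square_V[of w] m_comm[of t w] assms by force
  ultimately have "card {\<one>, t, w, t \<otimes> w} = card V" using assms card_V by auto
  moreover have "{\<one>, t, w, t \<otimes> w} \<subseteq> V" using assms by auto
  ultimately show ?thesis using card_subset_eq[OF finite_V] by metis
qed

lemma ex_V_avoiding:
  assumes "card A < 4" "finite A"
  obtains v where "v \<in> V" "v \<notin> A"
  using assms card_V card_mono[of A V] by (metis not_less subsetI)

text \<open>
  Two blocks with equal row products \<open>r\<close> and equal column products \<open>s\<close> fill the domino, and their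
  diagonals cancel. Two dominoes then give a tile: the blocks of the first one go on its diagonal,
  those of the second one on its antidiagonal. A domino excludes at most one value of \<open>r\<close> and \<open>s\<close>.
\<close>

definition block :: "'a \<Rightarrow> 'a \<Rightarrow> 'a \<Rightarrow> 'a \<Rightarrow> 'a \<Rightarrow> 'a \<Rightarrow> bool" where
  "block r s p1 p2 p3 p4 \<longleftrightarrow> {p1, p2, p3, p4} \<subseteq> carrier G \<and>
     p1 \<otimes> p2 = r \<and> p3 \<otimes> p4 = r \<and> p1 \<otimes> p3 = s \<and> p2 \<otimes> p4 = s"

definition domino :: "'a set \<Rightarrow> bool" where
  "domino D \<longleftrightarrow> (\<exists>\<sigma>\<in>V. \<forall>r\<in>V - {\<sigma>}. \<forall>s\<in>V - {\<sigma>}. r \<noteq> s \<longrightarrow>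
     (\<exists>p1 p2 p3 p4 q1 q2 q3 q4. block r s p1 p2 p3 p4 \<and> block r s q1 q2 q3 q4 \<and>
        (p1 \<otimes> p4) \<otimes> (q1 \<otimes> q4) = \<one> \<and> (p2 \<otimes> p3) \<otimes> (q2 \<otimes> q3) = \<one> \<and>
        D \<subseteq> {p1, p2, p3, p4, q1, q2, q3, q4}))"

lemma tile_of_dominoes:
  assumes "domino D" "domino E"
  shows "\<exists>T. zero_tile G T \<and> D \<union> E \<subseteq> tile_cells T"
proof -
  obtain \<sigma> where \<sigma>: "\<sigma> \<in> V" "\<And>r s. r \<in> V - {\<sigma>} \<Longrightarrow> s \<in> V - {\<sigma>} \<Longrightarrow> r \<noteq> s \<Longrightarrow>
     \<exists>p1 p2 p3 p4 q1 q2 q3 q4. block r s p1 p2 p3 p4 \<and> block r s q1 q2 q3 q4 \<and>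
        (p1 \<otimes> p4) \<otimes> (q1 \<otimes> q4) = \<one> \<and> (p2 \<otimes> p3) \<otimes> (q2 \<otimes> q3) = \<one> \<and>
        D \<subseteq> {p1, p2, p3, p4, q1, q2, q3, q4}"
    using assms(1) unfolding domino_def by blast
  obtain \<tau> where \<tau>: "\<tau> \<in> V" "\<And>r s. r \<in> V - {\<tau>} \<Longrightarrow> s \<in> V - {\<tau>} \<Longrightarrow> r \<noteq> s \<Longrightarrow>
     \<exists>p1 p2 p3 p4 q1 q2 q3 q4. block r s p1 p2 p3 p4 \<and> block r s q1 q2 q3 q4 \<and>
        (p1 \<otimes> p4) \<otimes> (q1 \<otimes> q4) = \<one> \<and> (p2 \<otimes> p3) \<otimes> (q2 \<otimes> q3) = \<one> \<and>
        E \<subseteq> {p1, p2, p3, p4, q1, q2, q3, q4}"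
    using assms(2) unfolding domino_def by blast
  \<comment> \<open>Each domino forbids one element of \<open>V\<close>, so of the four elements two
    remain for the common values \<open>r\<close> and \<open>s\<close>.\<close>
  obtain r where r: "r \<in> V" "r \<notin> {\<sigma>, \<tau>}" by (rule ex_V_avoiding[of "{\<sigma>, \<tau>}"]) (auto simp: card_insert_if)
  obtain s where s: "s \<in> V" "s \<notin> {\<sigma>, \<tau>, r}" by (rule ex_V_avoiding[of "{\<sigma>, \<tau>, r}"]) (auto simp: card_insert_if)
  have mem: "r \<in> V - {\<sigma>}" "s \<in> V - {\<sigma>}" "r \<in> V - {\<tau>}" "s \<in> V - {\<tau>}" "r \<noteq> s" using r s by auto
  obtain d1 d2 d3 d4 g1 g2 g3 g4 where D: "block r s d1 d2 d3 d4" "block r s g1 g2 g3 g4"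
    "(d1 \<otimes> d4) \<otimes> (g1 \<otimes> g4) = \<one>" "D \<subseteq> {d1, d2, d3, d4, g1, g2, g3, g4}"
    using \<sigma>(2)[OF mem(1,2,5)] by blast
  obtain e1 e2 e3 e4 f1 f2 f3 f4 where E: "block r s e1 e2 e3 e4" "block r s f1 f2 f3 f4"
    "(e2 \<otimes> e3) \<otimes> (f2 \<otimes> f3) = \<one>" "E \<subseteq> {e1, e2, e3, e4, f1, f2, f3, f4}"
    using \<tau>(2)[OF mem(3,4,5)] by blast
  \<comment> \<open>A row crosses two blocks and has product r r, a column s s, both trivial in
    \<open>V\<close>. The main diagonal sees only the first domino and the antidiagonal only the
    second.\<close>
  define T where "T = (\<lambda>i j. [[d1,d2,e1,e2],[d3,d4,e3,e4],[f1,f2,g1,g2],[f3,f4,g3,g4]] ! i ! j)"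
  have "zero_tile G T"
    unfolding T_def by (rule zero_tile_list) (use D E r s square_V in \<open>auto simp: block_def\<close>)
  moreover have "D \<union> E \<subseteq> tile_cells T"
    unfolding T_def tile_cells_list using D(4) E(4) by blast
  ultimately show ?thesis by blast
qed

text \<open>Each block has one of the two cosets on its diagonal and the other on its antidiagonal,
  so x cancels against its inverse in rows and columns. The second block exchanges the two cosets,
  which cancels x^2 against its inverse along the diagonals.\<close>

lemma domino_inverse:
  assumes x: "x \<in> carrier G"
  shows "domino ((V #> x) \<union> (V #> inv x))"
  unfolding domino_def
proof (intro bexI[of _ \<one>] ballI impI)
  fix r s assume rs: "r \<in> V - {\<one>}" "s \<in> V - {\<one>}" "r \<noteq> s"
  define y where "y = inv x"
  have y: "y \<in> carrier G" "x \<otimes> y = \<one>" using x by (simp_all add: y_def)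
  have xy: "x \<otimes> (y \<otimes> z) = z" if "z \<in> carrier G" for z using m_assoc[of x y z] x y that by simp
  \<comment> \<open>Half of each coset goes into the first block, as a translate of the subgroup {1,
    r s}. The factor \<open>w\<close> outside this subgroup supplies the other halves in the second
    block.\<close>
  obtain w where w: "w \<in> V" "w \<notin> {\<one>, r \<otimes> s}" by (rule ex_V_avoiding[of "{\<one>, r \<otimes> s}"]) (auto simp: card_insert_if)
  have V: "r \<in> V" "s \<in> V" "w \<in> V" using rs w by auto
  have G: "r \<in> carrier G" "s \<in> carrier G" "w \<in> carrier G" using V by auto
  note ac = G x y xy m_ac V V_cancel square_V
  have Veq: "V = {\<one>, r \<otimes> s, w, r \<otimes> s \<otimes> w}"
    by (rule V_eq) (use V w rs mult_eq_one_V in auto)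
  have "v \<in> {r, s, r \<otimes> w, s \<otimes> w}" if "v \<in> V" for v
  proof -
    have "r \<otimes> v \<in> V" using V that by simp
    then have "r \<otimes> v \<in> {\<one>, r \<otimes> s, w, r \<otimes> s \<otimes> w}" by (subst (asm) Veq)
    moreover have "v = r \<otimes> (r \<otimes> v)" using V that by (simp add: V_cancel)
    ultimately have "v \<in> (\<lambda>z. r \<otimes> z) ` {\<one>, r \<otimes> s, w, r \<otimes> s \<otimes> w}" by blast
    then show ?thesis using G V V_cancel by (simp add: m_assoc)
  qed
  then have Veq2: "V \<subseteq> {r, s, r \<otimes> w, s \<otimes> w}" by blast
  define p1 p2 p3 p4 where "p1 = x" "p2 = y \<otimes> r" "p3 = y \<otimes> s" "p4 = x \<otimes> (r \<otimes> s)"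
  define q1 q2 q3 q4 where "q1 = y \<otimes> (r \<otimes> w)" "q2 = x \<otimes> w" "q3 = x \<otimes> (r \<otimes> s \<otimes> w)" "q4 = y \<otimes> (s \<otimes> w)"
  note pq = p1_p2_p3_p4_def q1_q2_q3_q4_def
  have "block r s p1 p2 p3 p4" "block r s q1 q2 q3 q4"
    unfolding block_def pq by (simp_all add: ac)
  moreover have "(p1 \<otimes> p4) \<otimes> (q1 \<otimes> q4) = \<one>" "(p2 \<otimes> p3) \<otimes> (q2 \<otimes> q3) = \<one>"
    unfolding pq by (simp_all add: ac)
  moreover have "(V #> x) \<union> (V #> inv x) \<subseteq> {p1, p2, p3, p4, q1, q2, q3, q4}"
  proof -
    have "V #> x \<subseteq> {p1, q2, p4, q3}"
      unfolding r_coset_def pq using G x by (subst Veq) (auto simp: m_comm)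
    moreover have "V #> y \<subseteq> {p2, p3, q1, q4}"
      unfolding r_coset_def pq using Veq2 G y by (auto simp: m_comm)
    ultimately show ?thesis unfolding y_def by blast
  qed
  ultimately show "\<exists>p1 p2 p3 p4 q1 q2 q3 q4. block r s p1 p2 p3 p4 \<and> block r s q1 q2 q3 q4 \<and>
        (p1 \<otimes> p4) \<otimes> (q1 \<otimes> q4) = \<one> \<and> (p2 \<otimes> p3) \<otimes> (q2 \<otimes> q3) = \<one> \<and>
        (V #> x) \<union> (V #> inv x) \<subseteq> {p1, p2, p3, p4, q1, q2, q3, q4}"
    by blast
qed simp

text \<open>With p = u^2 in \<open>V\<close>, the coset of u fills a block alone: u times u (p r) is
  r. The excluded value is p, because r = p or s = p would repeat the entry u. Multiplying this
  block by d gives the other one with the same products; both diagonals of either block give p r s,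
  whose square is one.\<close>

lemma domino_self_inverse:
  assumes u: "u \<in> carrier G" "u \<otimes> u \<in> V" and d: "d \<in> carrier G" "d \<otimes> d = \<one>"
  shows "domino ((V #> u) \<union> (V #> (u \<otimes> d)))"
  unfolding domino_def
proof (intro bexI[of _ "u \<otimes> u"] ballI impI)
  fix r s assume rs: "r \<in> V - {u \<otimes> u}" "s \<in> V - {u \<otimes> u}" "r \<noteq> s"
  define p where "p = u \<otimes> u"
  have V: "r \<in> V" "s \<in> V" "p \<in> V" "r \<noteq> p" "s \<noteq> p" using rs u by (auto simp: p_def)
  have G: "r \<in> carrier G" "s \<in> carrier G" "p \<in> carrier G" using V by auto
  have uu: "u \<otimes> u = p" by (simp add: p_def)
  have uuz: "u \<otimes> (u \<otimes> z) = p \<otimes> z" if "z \<in> carrier G" for z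
    using m_assoc[of u u z] u that by (simp add: p_def)
  have dd: "d \<otimes> (d \<otimes> z) = z" if "z \<in> carrier G" for z
    using m_assoc[of d d z] d that by simp
  note ac = G u(1) d uu uuz dd m_ac V V_cancel square_V
  have "V = {\<one>, p \<otimes> r, p \<otimes> s, (p \<otimes> r) \<otimes> (p \<otimes> s)}"
    by (rule V_eq) (use V G rs mult_eq_one_V in auto)
  also have "(p \<otimes> r) \<otimes> (p \<otimes> s) = r \<otimes> s" by (simp add: ac)
  finally have Veq: "V = {\<one>, p \<otimes> r, p \<otimes> s, r \<otimes> s}" .
  define p1 p2 p3 p4 where "p1 = u" "p2 = u \<otimes> (p \<otimes> r)" "p3 = u \<otimes> (p \<otimes> s)" "p4 = u \<otimes> (r \<otimes> s)"
  define q1 q2 q3 q4 where "q1 = u \<otimes> d" "q2 = (u \<otimes> d) \<otimes> (p \<otimes> r)" "q3 = (u \<otimes> d) \<otimes> (p \<otimes> s)" "q4 = (u \<otimes> d) \<otimes> (r \<otimes> s)"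
  note pq = p1_p2_p3_p4_def q1_q2_q3_q4_def
  have "block r s p1 p2 p3 p4" "block r s q1 q2 q3 q4"
    unfolding block_def pq by (simp_all add: ac)
  moreover have "(p1 \<otimes> p4) \<otimes> (q1 \<otimes> q4) = \<one>" "(p2 \<otimes> p3) \<otimes> (q2 \<otimes> q3) = \<one>"
    unfolding pq by (simp_all add: ac)
  moreover have "(V #> u) \<union> (V #> (u \<otimes> d)) \<subseteq> {p1, p2, p3, p4, q1, q2, q3, q4}"
  proof -
    have "V #> u \<subseteq> {p1, p2, p3, p4}"
      unfolding r_coset_def pq using G u(1) by (subst Veq) (auto simp: m_comm)
    moreover have "V #> (u \<otimes> d) \<subseteq> {q1, q2, q3, q4}"
      unfolding r_coset_def pq using G u(1) d(1) by (subst Veq) (auto simp: m_comm[of _ "u \<otimes> d"])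
    ultimately show ?thesis by blast
  qed
  ultimately show "\<exists>p1 p2 p3 p4 q1 q2 q3 q4. block r s p1 p2 p3 p4 \<and> block r s q1 q2 q3 q4 \<and>
        (p1 \<otimes> p4) \<otimes> (q1 \<otimes> q4) = \<one> \<and> (p2 \<otimes> p3) \<otimes> (q2 \<otimes> q3) = \<one> \<and>
        (V #> u) \<union> (V #> (u \<otimes> d)) \<subseteq> {p1, p2, p3, p4, q1, q2, q3, q4}"
    by blast
qed (use u in simp)

text \<open>A family covering 16 t elements has 2 t dominoes, which are joined two by two in an
  arbitrary order. The divisibility by 8 later yields a contradiction by counting.\<close>

lemma tiles_of_domino_family:
  assumes fin: "finite \<D>" "finite (\<Union>\<D>)" and D: "\<And>D. D \<in> \<D> \<Longrightarrow> domino D \<and> card D = 8"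
    and disj: "\<And>D E. D \<in> \<D> \<Longrightarrow> E \<in> \<D> \<Longrightarrow> D \<noteq> E \<Longrightarrow> D \<inter> E = {}"
  shows "8 dvd card (\<Union>\<D>)"
    and "card (\<Union>\<D>) = 16 * t \<Longrightarrow> \<exists>T. (\<forall>i<t. zero_tile G (T i)) \<and> \<Union>\<D> \<subseteq> (\<Union>i<t. tile_cells (T i))"
proof -
  have card: "8 * card \<D> = card (\<Union>\<D>)"
    by (rule card_partition) (use fin D disj in auto)
  then show "8 dvd card (\<Union>\<D>)" by (metis dvd_triv_left)
  assume "card (\<Union>\<D>) = 16 * t"
  then have c: "card \<D> = 2 * t" using card by simp
  obtain f where f: "bij_betw f {..<2 * t} \<D>"
    using ex_bij_betw_nat_finite[OF fin(1)] c by (auto simp: lessThan_atLeast0)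
  have "\<exists>T. zero_tile G T \<and> f (2 * i) \<union> f (2 * i + 1) \<subseteq> tile_cells T" if "i < t" for i
    by (rule tile_of_dominoes) (use bij_betwE[OF f] D that in auto)
  then obtain T where T: "\<And>i. i < t \<Longrightarrow> zero_tile G (T i) \<and> f (2 * i) \<union> f (2 * i + 1) \<subseteq> tile_cells (T i)"
    by metis
  have "\<Union>\<D> \<subseteq> (\<Union>i<t. tile_cells (T i))"
  proof
    fix x assume "x \<in> \<Union>\<D>"
    then obtain D where "D \<in> \<D>" "x \<in> D" by blast
    then obtain j where j: "j < 2 * t" "x \<in> f j" using f by (auto simp: bij_betw_def)
    then have i: "j div 2 < t" by auto
    have "j = 2 * (j div 2) \<or> j = 2 * (j div 2) + 1" by presburger
    then have "x \<in> f (2 * (j div 2)) \<union> f (2 * (j div 2) + 1)" using j(2) by auto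
    then show "x \<in> (\<Union>i<t. tile_cells (T i))" using T[OF i] i by blast
  qed
  then show "\<exists>T. (\<forall>i<t. zero_tile G (T i)) \<and> \<Union>\<D> \<subseteq> (\<Union>i<t. tile_cells (T i))" using T by blast
qed

end

section \<open>Pairing the cosets of \<open>V\<close> into dominoes\<close>

context klein
begin

lemma coset_eq: "x \<in> carrier G \<Longrightarrow> y \<in> V #> x \<Longrightarrow> V #> y = V #> x"
  using repr_independence subgroup_V by metis

lemma coset_self: "x \<in> carrier G \<Longrightarrow> x \<in> V #> x"
  by (rule rcos_self[OF _ subgroup_V])

lemma coset_subset: "x \<in> carrier G \<Longrightarrow> V #> x \<subseteq> carrier G"
  using r_coset_subset_G V.subset by simp

lemma card_coset: "x \<in> carrier G \<Longrightarrow> card (V #> x) = 4"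
  using card_rcosets_equal[of "V #> x" V] rcosetsI[of V x] V.subset card_V by simp

lemma coset_square:
  assumes "x \<in> carrier G" "y \<in> V #> x"
  shows "y \<otimes> y = x \<otimes> x"
proof -
  obtain v where v: "v \<in> V" "y = v \<otimes> x" using assms by (auto simp: r_coset_def)
  then have "y \<otimes> y = v \<otimes> (v \<otimes> (x \<otimes> x))" using assms V.mem_carrier[OF v(1)] by (simp add: m_ac)
  then show ?thesis using V_cancel v assms by simp
qed

lemma coset_inv:
  assumes "x \<in> carrier G" "y \<in> V #> x"
  shows "inv y \<in> V #> inv x"
proof -
  obtain v where v: "v \<in> V" "y = v \<otimes> x" using assms by (auto simp: r_coset_def)
  then have "inv y = inv v \<otimes> inv x" using assms by (simp add: inv_mult)
  then show ?thesis using v by (auto simp: r_coset_def)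
qed

lemma coset_mult:
  assumes "x \<in> carrier G" "y \<in> V #> x" "d \<in> carrier G"
  shows "y \<otimes> d \<in> V #> (x \<otimes> d)"
proof -
  obtain v where v: "v \<in> V" "y = v \<otimes> x" using assms by (auto simp: r_coset_def)
  then have "y \<otimes> d = v \<otimes> (x \<otimes> d)" using assms by (simp add: m_assoc)
  then show ?thesis using v by (auto simp: r_coset_def)
qed

lemma coset_disjoint:
  assumes "x \<in> carrier G" "y \<in> carrier G" "V #> x \<noteq> V #> y"
  shows "(V #> x) \<inter> (V #> y) = {}"
  using assms coset_eq by blast

text \<open>This detects the cosets that cannot be paired with the coset of the inverse.\<close>

lemma inv_in_coset_iff:
  assumes "x \<in> carrier G"
  shows "inv x \<in> V #> x \<longleftrightarrow> x \<otimes> x \<in> V"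
proof
  assume "inv x \<in> V #> x"
  then obtain v where v: "v \<in> V" "inv x = v \<otimes> x" by (auto simp: r_coset_def)
  have "v \<otimes> (x \<otimes> x) = inv x \<otimes> x" unfolding v(2) using assms V.mem_carrier[OF v(1)] by (simp add: m_assoc)
  then have "v \<otimes> (x \<otimes> x) = \<one>" using assms by simp
  then have "x \<otimes> x = v" using V_cancel[OF v(1), of "x \<otimes> x"] v assms by simp
  then show "x \<otimes> x \<in> V" using v by simp
next
  assume "x \<otimes> x \<in> V"
  then have "inv (x \<otimes> x) \<in> V" by simp
  moreover have "inv x = inv (x \<otimes> x) \<otimes> x" using assms by (simp add: inv_mult m_assoc)
  ultimately show "inv x \<in> V #> x" by (auto simp: r_coset_def)
qed

text \<open>
  The coset of \<open>x\<close> is paired with that of its inverse; if these coincide, it is paired with the coset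
  of \<open>x d\<close> for an involution \<open>d\<close> outside \<open>V\<close>.
\<close>

lemma tiles_of_closed_set:
  assumes S: "S \<subseteq> carrier G" "\<And>x. x \<in> S \<Longrightarrow> V #> x \<subseteq> S"
    and inv: "\<And>x. x \<in> S \<Longrightarrow> x \<otimes> x \<notin> V \<Longrightarrow> inv x \<in> S"
    and d: "d \<in> carrier G" "d \<otimes> d = \<one>" "\<And>x. x \<in> S \<Longrightarrow> x \<otimes> x \<in> V \<Longrightarrow> d \<notin> V \<and> x \<otimes> d \<in> S"
  shows "8 dvd card S"
    and "card S = 16 * t \<Longrightarrow> \<exists>T. (\<forall>i<t. zero_tile G (T i)) \<and> S \<subseteq> (\<Union>i<t. tile_cells (T i))"
proof -
  \<comment> \<open>The map \<open>e\<close> respects cosets (\<open>e_coset\<close>), is its own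
    inverse (\<open>ee\<close>) and maps no element into its own coset (\<open>ne\<close>). Hence
    the sets \<open>P x\<close> are dominoes of exactly eight elements that partition
    \<open>S\<close>.\<close>
  define e where "e x = (if x \<otimes> x \<in> V then x \<otimes> d else inv x)" for x
  define P where "P x = (V #> x) \<union> (V #> e x)" for x
  have SG: "x \<in> carrier G" if "x \<in> S" for x using S that by blast
  have eS: "e x \<in> S" if "x \<in> S" for x using that inv d by (simp add: e_def)
  have e_coset: "V #> e y = V #> e x" if "x \<in> S" "y \<in> V #> x" for x y
  proof -
    have G: "x \<in> carrier G" "e x \<in> carrier G" using SG that eS by auto
    have "y \<otimes> y = x \<otimes> x" using coset_square G that by blast
    then have "e y \<in> V #> e x"
      using coset_inv[OF G(1) that(2)] coset_mult[OF G(1) that(2) d(1)] by (simp add: e_def)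
    then show ?thesis using coset_eq G by blast
  qed
  have ee: "e (e x) = x" if "x \<in> S" for x
  proof (cases "x \<otimes> x \<in> V")
    case True
    have "(x \<otimes> d) \<otimes> (x \<otimes> d) = (x \<otimes> x) \<otimes> (d \<otimes> d)" using SG[OF that] d(1) by (simp add: m_ac)
    then have "(x \<otimes> d) \<otimes> (x \<otimes> d) = x \<otimes> x" using SG[OF that] d by simp
    then show ?thesis using True SG[OF that] d by (simp add: e_def m_assoc)
  next
    case False
    have "inv (x \<otimes> x) = inv x \<otimes> inv x" using SG[OF that] by (simp add: inv_mult)
    then have "inv x \<otimes> inv x \<notin> V" using False SG[OF that] V.m_inv_closed[of "inv x \<otimes> inv x"]
      by (metis inv_inv m_closed)
    then show ?thesis using False SG[OF that] by (simp add: e_def)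
  qed
  have ne: "V #> x \<noteq> V #> e x" if "x \<in> S" for x
  proof
    assume "V #> x = V #> e x"
    then have *: "e x \<in> V #> x" using coset_self SG eS that by metis
    show False
    proof (cases "x \<otimes> x \<in> V")
      case True
      then obtain v where v: "v \<in> V" "x \<otimes> d = v \<otimes> x" using * by (auto simp: r_coset_def e_def)
      then have "x \<otimes> d = x \<otimes> v" using SG that by (simp add: m_comm)
      then have "d = v" using SG that d v by simp
      then show False using d(3)[OF that True] v by simp
    next
      case False
      then show False using * inv_in_coset_iff SG that by (simp add: e_def)
    qed
  qed
  have P_eq: "P y = P x" if xy: "x \<in> S" "y \<in> P x" for x y
  proof -
    consider "y \<in> V #> x" | "y \<in> V #> e x" using xy by (auto simp: P_def)
    then show ?thesis
    proof cases
      case 1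
      then show ?thesis unfolding P_def
        by (simp only: coset_eq[OF SG[OF xy(1)] 1] e_coset[OF xy(1) 1])
    next
      case 2
      have "V #> y = V #> e x" "V #> e y = V #> x"
        using coset_eq[OF SG[OF eS[OF xy(1)]] 2] e_coset[OF eS[OF xy(1)] 2] ee[OF xy(1)] by simp_all
      then show ?thesis unfolding P_def by blast
    qed
  qed
  define \<D> where "\<D> = P ` S"
  have finS: "finite S" using S finite_carrier finite_subset by blast
  have U: "\<Union>\<D> = S"
  proof
    show "\<Union>\<D> \<subseteq> S" unfolding \<D>_def P_def using S(2) S(2)[OF eS] by blast
    show "S \<subseteq> \<Union>\<D>" unfolding \<D>_def P_def using coset_self SG by blast
  qed
  have D: "domino D \<and> card D = 8" if D: "D \<in> \<D>" for D
  proof -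
    obtain x where x: "x \<in> S" "D = P x" using D by (auto simp: \<D>_def)
    have "domino D"
      using domino_inverse[OF SG[OF x(1)]] domino_self_inverse[OF SG[OF x(1)] _ d(1,2)] x
      by (simp add: P_def e_def)
    moreover have "card D = card (V #> x) + card (V #> e x)"
      unfolding x(2) P_def using x SG eS ne coset_disjoint coset_subset finite_subset[OF _ finite_carrier]
      by (intro card_Un_disjoint) auto
    ultimately show ?thesis using card_coset SG eS x by simp
  qed
  have disj: "D \<inter> E = {}" if DE: "D \<in> \<D>" "E \<in> \<D>" "D \<noteq> E" for D E
  proof (rule ccontr)
    assume "D \<inter> E \<noteq> {}"
    then obtain z where z: "z \<in> D" "z \<in> E" by blast
    obtain x y where "x \<in> S" "D = P x" "y \<in> S" "E = P y" using DE by (auto simp: \<D>_def)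
    then show False using P_eq[of x z] P_eq[of y z] z DE by simp
  qed
  have fin: "finite \<D>" "finite (\<Union>\<D>)" using finS U by (auto simp: \<D>_def)
  show "8 dvd card S"
    and "card S = 16 * t \<Longrightarrow> \<exists>T. (\<forall>i<t. zero_tile G (T i)) \<and> S \<subseteq> (\<Union>i<t. tile_cells (T i))"
    using tiles_of_domino_family[OF fin D disj] U by simp_all
qed

end

section \<open>The special tile when \<open>V\<close> contains every involution\<close>

lemma (in group) int_pow_eq_one_if_dvd:
  assumes "x \<in> carrier G" "x [^] (m::int) = \<one>" "m dvd i"
  shows "x [^] i = \<one>"
  using assms by (auto simp: int_pow_pow[symmetric] elim!: dvdE)

context klein
begin

text \<open>
  If \<open>V\<close> contains all involutions, the cosets that are their own inverses cannot be paired. There are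
  at most four of them, and they are put into one special tile.
\<close>

lemma tiles_of_special_tile:
  assumes R: "finite R" "R \<subseteq> carrier G" "card R = 4" "inj_on (\<lambda>w. V #> w) R"
    and R_inv: "\<And>w. w \<in> R \<Longrightarrow> \<exists>w'\<in>R. inv w \<in> V #> w'"
    and self: "\<And>x. x \<in> carrier G \<Longrightarrow> x \<otimes> x \<in> V \<Longrightarrow> \<exists>w\<in>R. x \<in> V #> w"
    and U: "zero_tile G U" "(\<Union>w\<in>R. V #> w) \<subseteq> tile_cells U"
    and n: "order G = 16 * m" "m > 0"
  shows "\<exists>T. (\<forall>t<m. zero_tile G (T t)) \<and> carrier G \<subseteq> (\<Union>t<m. tile_cells (T t))"
proof -
  define W where "W = (\<Union>w\<in>R. V #> w)"
  define S where "S = carrier G - W"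
  have RG: "w \<in> carrier G" if "w \<in> R" for w using R that by blast
  have WG: "W \<subseteq> carrier G" unfolding W_def using coset_subset RG by blast
  have "4 * card ((\<lambda>w. V #> w) ` R) = card (\<Union>((\<lambda>w. V #> w) ` R))"
  proof (rule card_partition)
    show "finite (\<Union>((\<lambda>w. V #> w) ` R))" using WG finite_carrier finite_subset unfolding W_def by blast
    fix C D assume "C \<in> (\<lambda>w. V #> w) ` R" "D \<in> (\<lambda>w. V #> w) ` R" "C \<noteq> D"
    then show "C \<inter> D = {}" using coset_disjoint RG by blast
  qed (use R card_coset RG in auto)
  then have cW: "card W = 16" using R by (simp add: W_def card_image)
  have W_inv: "inv x \<in> W" if x: "x \<in> W" for x
  proof -
    obtain w where w: "w \<in> R" "x \<in> V #> w" using x by (auto simp: W_def)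
    obtain w' where w': "w' \<in> R" "inv w \<in> V #> w'" using R_inv w by blast
    have "inv x \<in> V #> inv w" using coset_inv RG w by blast
    then have "inv x \<in> V #> w'" using coset_eq[OF RG w'(2)] w' by simp
    then show ?thesis using w' by (auto simp: W_def)
  qed
  \<comment> \<open>Taking out one tile leaves a multiple of 16, so the dominoes of \<open>S\<close>
    still come in pairs. No element of \<open>S\<close> has its square in \<open>V\<close>; the
    condition on \<open>d\<close> below is therefore vacuous and \<open>\<one>\<close> is a
    placeholder.\<close>
  have cS: "card S = 16 * (m - 1)"
    using cW n WG finite_carrier by (simp add: S_def card_Diff_subset finite_subset order_def diff_mult_distrib2)
  have "\<exists>T. (\<forall>i<m - 1. zero_tile G (T i)) \<and> S \<subseteq> (\<Union>i<m - 1. tile_cells (T i))"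
  proof (rule tiles_of_closed_set(2)[where d = \<one>])
    show "S \<subseteq> carrier G" by (auto simp: S_def)
    fix x assume x: "x \<in> S"
    then have xG: "x \<in> carrier G" "x \<notin> W" by (auto simp: S_def)
    show "V #> x \<subseteq> S"
    proof
      fix y assume y: "y \<in> V #> x"
      have "y \<notin> W"
      proof
        assume "y \<in> W"
        then obtain w where w: "w \<in> R" "y \<in> V #> w" by (auto simp: W_def)
        then have "V #> x = V #> w" using coset_eq[OF xG(1) y] coset_eq[OF RG w(2)] by simp
        then show False using coset_self[OF xG(1)] xG(2) w by (auto simp: W_def)
      qed
      then show "y \<in> S" using y coset_subset xG by (auto simp: S_def)
    qed
    show "inv x \<in> S" using W_inv[of "inv x"] xG by (auto simp: S_def)
    assume "x \<otimes> x \<in> V"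
    then show "\<one> \<notin> V \<and> x \<otimes> \<one> \<in> S" using self xG by (auto simp: W_def)
  qed (use cS in auto)
  then obtain T where T: "\<forall>i<m - 1. zero_tile G (T i)" "S \<subseteq> (\<Union>i<m - 1. tile_cells (T i))" by blast
  define T' where "T' = T(m - 1 := U)"
  have "zero_tile G (T' t)" if "t < m" for t using T U that by (auto simp: T'_def)
  moreover have "carrier G \<subseteq> (\<Union>t<m. tile_cells (T' t))"
  proof
    fix x assume "x \<in> carrier G"
    then consider "x \<in> W" | "x \<in> S" by (auto simp: S_def)
    then show "x \<in> (\<Union>t<m. tile_cells (T' t))"
    proof cases
      case 1
      then have "x \<in> tile_cells (T' (m - 1))" using U by (auto simp: W_def T'_def)
      then show ?thesis using n by (intro UN_I[of "m - 1"]) auto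
    next
      case 2
      then obtain i where "i < m - 1" "x \<in> tile_cells (T i)" using T by blast
      then show ?thesis by (intro UN_I[of i]) (auto simp: T'_def)
    qed
  qed
  ultimately show ?thesis by blast
qed

text \<open>The quotient of the two elements squares to one, so it is trivial or an involution and
  lies in \<open>V\<close>. A self-inverse coset is thus determined by its square.\<close>

lemma coset_if_square_eq:
  assumes "involutions G \<subseteq> V" "x \<in> carrier G" "w \<in> carrier G" "x \<otimes> x = w \<otimes> w"
  shows "x \<in> V #> w"
proof -
  define z where "z = x \<otimes> inv w"
  have z: "z \<in> carrier G" "x = z \<otimes> w" using assms by (simp_all add: z_def m_assoc)
  have "z \<otimes> z = (x \<otimes> x) \<otimes> inv (w \<otimes> w)" using assms(2,3) by (simp add: z_def inv_mult m_ac)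
  then have "z \<otimes> z = \<one>" using assms by simp
  then have "z \<in> V" using z assms(1) by (cases "z = \<one>") (auto simp: involutions_def)
  then show ?thesis using z by (auto simp: r_coset_def)
qed

lemma V_trivial_coset: "V #> \<one> = V"
  using V.subset by simp

lemma int_pow_2: "x \<in> carrier G \<Longrightarrow> x [^] (2::int) = x \<otimes> x"
  using int_pow_mult[of x 1 1] by simp

lemma int_pow_4: "x \<in> carrier G \<Longrightarrow> x \<otimes> x \<in> V \<Longrightarrow> x [^] (4::int) = \<one>"
  using int_pow_mult[of x 2 2] square_V by (simp add: int_pow_2)

text \<open>The squares of x and y generate \<open>V\<close>, so x and y generate a copy of Z_4 x
  Z_4. This group of 16 elements is the union of the self-inverse cosets and becomes the special
  tile.\<close>

lemma tile_cover_all_squares: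
  assumes inv: "involutions G \<subseteq> V"
    and x: "x \<in> carrier G" "x \<otimes> x \<in> V" "x \<otimes> x \<noteq> \<one>"
    and y: "y \<in> carrier G" "y \<otimes> y \<in> V" "y \<otimes> y \<noteq> \<one>" "y \<otimes> y \<noteq> x \<otimes> x"
    and n: "order G = 16 * m" "m > 0"
  shows "\<exists>T. (\<forall>t<m. zero_tile G (T t)) \<and> carrier G \<subseteq> (\<Union>t<m. tile_cells (T t))"
proof -
  define g where "g i j = x [^] (i::int) \<otimes> y [^] (j::int)" for i j
  have gG: "g i j \<in> carrier G" for i j using x y by (simp add: g_def)
  have g_mult: "g i j \<otimes> g k l = g (i + k) (j + l)" for i j k l
    using x(1) y(1) by (simp add: g_def int_pow_mult m_ac)
  have g_one: "g i j = \<one>" if "4 dvd i" "4 dvd j" for i j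
    using that int_pow_eq_one_if_dvd[OF x(1) int_pow_4[OF x(1,2)]]
      int_pow_eq_one_if_dvd[OF y(1) int_pow_4[OF y(1,2)]] by (simp add: g_def)
  have xx: "x \<otimes> x = g 2 0" and yy: "y \<otimes> y = g 0 2"
    using x y by (simp_all add: g_def int_pow_2)
  have V: "V = {g 0 0, g 2 0, g 0 2, g 2 2}"
    using V_eq[of "g 2 0" "g 0 2"] x y xx yy g_one[of 0 0] by (simp add: g_mult)
  define R where "R = {g 0 0, g 1 0, g 0 1, g 1 1}"
  have sq: "g 0 0 \<otimes> g 0 0 = g 0 0" "g 1 0 \<otimes> g 1 0 = g 2 0" "g 0 1 \<otimes> g 0 1 = g 0 2" "g 1 1 \<otimes> g 1 1 = g 2 2"
    by (simp_all add: g_mult)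
  have "card {g 0 0, g 2 0, g 0 2, g 2 2} = 4" using card_V V by simp
  then have dist: "distinct [g 0 0, g 2 0, g 0 2, g 2 2]"
    using card_distinct[of "[g 0 0, g 2 0, g 0 2, g 2 2]"] by simp
  have inj_sq: "inj_on (\<lambda>w. w \<otimes> w) R" using dist unfolding R_def by (auto simp: sq)
  have cR: "card R = 4" using dist unfolding R_def by (auto simp: card_insert_if) (metis sq)+
  \<comment> \<open>A zero-sum magic square of Z_4 x Z_4 written by its exponent pairs: on every
    line both exponent sums are multiples of 4.\<close>
  define U where "U = (\<lambda>i j. [[g 2 2, g 0 3, g 3 2, g 3 1], [g 3 3, g 3 0, g 0 1, g 2 0],
    [g 2 3, g 0 2, g 1 1, g 1 2], [g 1 0, g 1 3, g 0 0, g 2 1]] ! i ! j)"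
  show ?thesis
  proof (rule tiles_of_special_tile[where R = R and U = U])
    show "finite R" "R \<subseteq> carrier G" using gG by (auto simp: R_def)
    show "card R = 4" by fact
    show "inj_on (\<lambda>w. V #> w) R"
    proof (rule inj_onI)
      fix u w assume uw: "u \<in> R" "w \<in> R" "V #> u = V #> w"
      then have G: "u \<in> carrier G" "w \<in> carrier G" using gG by (auto simp: R_def)
      then have "u \<in> V #> w" using coset_self uw by blast
      then have "u \<otimes> u = w \<otimes> w" using coset_square G by blast
      then show "u = w" using inj_sq uw by (auto dest: inj_onD)
    qed
    show "\<exists>w'\<in>R. inv w \<in> V #> w'" if "w \<in> R" for w
    proof
      have "w \<in> carrier G" using that gG by (auto simp: R_def)
      moreover have "w \<otimes> w \<in> V" using that unfolding R_def V by (auto simp: sq)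
      ultimately show "inv w \<in> V #> w" using inv_in_coset_iff by blast
    qed fact
    show "\<exists>w\<in>R. z \<in> V #> w" if z: "z \<in> carrier G" "z \<otimes> z \<in> V" for z
    proof -
      have "\<exists>w\<in>R. z \<otimes> z = w \<otimes> w" using z(2) unfolding R_def V by (auto simp: sq)
      then show ?thesis using coset_if_square_eq[OF inv z(1)] gG unfolding R_def by blast
    qed
    show "zero_tile G U"
      unfolding U_def by (rule zero_tile_list) (simp_all add: gG g_mult g_one)
    show "(\<Union>w\<in>R. V #> w) \<subseteq> tile_cells U"
      unfolding U_def tile_cells_list R_def r_coset_def V by (simp add: g_mult)
  qed fact+
qed

text \<open>Only \<open>V\<close> and the coset of q are self-inverse, which is half a tile. The
  mutually inverse cosets of y and \<open>inv y\<close>, distinct because y^2 is not in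
  \<open>V\<close>, provide the other half.\<close>

lemma tile_cover_one_square:
  assumes inv: "involutions G \<subseteq> V"
    and q: "q \<in> carrier G" "q \<otimes> q \<in> V" "q \<otimes> q \<noteq> \<one>"
    and sqs: "\<And>z. z \<in> carrier G \<Longrightarrow> z \<otimes> z \<in> V \<Longrightarrow> z \<otimes> z = \<one> \<or> z \<otimes> z = q \<otimes> q"
    and y: "y \<in> carrier G" "y \<otimes> y \<notin> V"
    and n: "order G = 16 * m" "m > 0"
  shows "\<exists>T. (\<forall>t<m. zero_tile G (T t)) \<and> carrier G \<subseteq> (\<Union>t<m. tile_cells (T t))"
proof -
  \<comment> \<open>With q^2 this second generator spans \<open>V\<close>, so all four cosets are
    described by exponents of y, q and b.\<close>
  obtain b where b: "b \<in> V" "b \<notin> {\<one>, q \<otimes> q}"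
    by (rule ex_V_avoiding[of "{\<one>, q \<otimes> q}"]) (auto simp: card_insert_if)
  have bG: "b \<in> carrier G" using b by simp
  define g where "g e i j = y [^] (e::int) \<otimes> (q [^] (i::int) \<otimes> b [^] (j::int))" for e i j
  have gG: "g e i j \<in> carrier G" for e i j using q y bG by (simp add: g_def)
  have g_mult: "g e i j \<otimes> g f k l = g (e + f) (i + k) (j + l)" for e i j f k l
    using q(1) y(1) bG by (simp add: g_def int_pow_mult m_ac)
  have b2: "b [^] (2::int) = \<one>" using int_pow_2 bG b square_V by simp
  have g_one: "g 0 i j = \<one>" if "4 dvd i" "2 dvd j" for i j
    using that int_pow_eq_one_if_dvd[OF q(1) int_pow_4[OF q(1,2)]]
      int_pow_eq_one_if_dvd[OF bG b2] by (simp add: g_def)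
  have reps: "q = g 0 1 0" "y = g 1 0 0" "inv y = g (- 1) 0 0" "\<one> = g 0 0 0" "q \<otimes> q = g 0 2 0" "b = g 0 0 1"
    using q y bG by (simp_all add: g_def int_pow_2 int_pow_neg)
  have "V = {\<one>, q \<otimes> q, b, (q \<otimes> q) \<otimes> b}" by (rule V_eq) (use q b in auto)
  then have V: "V = {g 0 0 0, g 0 2 0, g 0 0 1, g 0 2 1}"
    unfolding reps by (simp add: g_mult)
  define R where "R = {\<one>, q, y, inv y}"
  have oneV: "V #> w \<noteq> V #> w'" if "w \<in> carrier G" "w' \<in> carrier G" "w \<otimes> w \<noteq> w' \<otimes> w'" for w w'
    using coset_square[of w' w] coset_self[of w] that by metis
  have iy: "inv y \<otimes> inv y \<notin> V"
  proof
    assume "inv y \<otimes> inv y \<in> V"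
    then have "inv (inv y \<otimes> inv y) \<in> V" by simp
    then show False using y by (simp add: inv_mult)
  qed
  have c: "V #> \<one> \<noteq> V #> q" "V #> \<one> \<noteq> V #> y" "V #> \<one> \<noteq> V #> inv y" "V #> q \<noteq> V #> y" "V #> q \<noteq> V #> inv y"
  proof -
    have "\<one> \<otimes> \<one> \<noteq> q \<otimes> q" using q by simp
    then show "V #> \<one> \<noteq> V #> q" using q by (intro oneV) auto
    have ne: "V #> w \<noteq> V #> w'" if "w \<in> carrier G" "w' \<in> carrier G" "w \<otimes> w \<in> V" "w' \<otimes> w' \<notin> V" for w w'
      using oneV[OF that(1,2)] that(3,4) by metis
    show "V #> \<one> \<noteq> V #> y" "V #> \<one> \<noteq> V #> inv y" "V #> q \<noteq> V #> y" "V #> q \<noteq> V #> inv y"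
      by (rule ne; use q y iy in simp)+
  qed
  have c2: "V #> y \<noteq> V #> inv y"
    using inv_in_coset_iff[OF y(1)] y coset_self[of "inv y"] by auto
  \<comment> \<open>The order of y is not known, so its exponents sum to the integer 0 on every
    line; those of q sum to a multiple of 4 and those of b to an even number.\<close>
  define U where "U = (\<lambda>i j. [[g 1 2 0, g 0 1 1, g 0 1 0, g (- 1) 0 1], [g (- 1) 2 1, g 0 0 1, g 0 2 0, g 1 0 0],
    [g (- 1) 2 0, g 0 0 0, g 0 2 1, g 1 0 1], [g 1 2 1, g 0 3 0, g 0 3 1, g (- 1) 0 0]] ! i ! j)"
  show ?thesis
  proof (rule tiles_of_special_tile[where R = R and U = U])
    show "finite R" "R \<subseteq> carrier G" using q y by (auto simp: R_def)
    show "inj_on (\<lambda>w. V #> w) R" using c c2 unfolding R_def by (auto simp del: coset_mult_one)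
    have "distinct [\<one>, q, y, inv y]" using c c2 by auto
    then show "card R = 4" unfolding R_def using distinct_card[of "[\<one>, q, y, inv y]"] by simp
    show "\<exists>w'\<in>R. inv w \<in> V #> w'" if w: "w \<in> R" for w
    proof -
      consider "w = \<one>" | "w = q" | "w = y" | "w = inv y" using w unfolding R_def by blast
      then show ?thesis
      proof cases
        case 1 then show ?thesis unfolding R_def using coset_self[of \<one>] by auto
      next
        case 2 then show ?thesis unfolding R_def using inv_in_coset_iff q by blast
      next
        case 3 then show ?thesis unfolding R_def using coset_self[of "inv y"] y by auto
      next
        case 4 then show ?thesis unfolding R_def using coset_self[of y] y by auto
      qed
    qed
    show "\<exists>w\<in>R. z \<in> V #> w" if z: "z \<in> carrier G" "z \<otimes> z \<in> V" for z
      using sqs[OF z] coset_if_square_eq[OF inv z(1), of \<one>] coset_if_square_eq[OF inv z(1) q(1)]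
      unfolding R_def by auto
    show "zero_tile G U"
      unfolding U_def by (rule zero_tile_list) (simp_all add: gG g_mult g_one)
    have R': "R = {g 0 0 0, g 0 1 0, g 1 0 0, g (- 1) 0 0}" unfolding R_def by (simp only: reps(3)) (simp only: reps(1,2,4)[symmetric])
    show "(\<Union>w\<in>R. V #> w) \<subseteq> tile_cells U"
      unfolding U_def tile_cells_list R' r_coset_def V by (simp add: g_mult)
  qed fact+
qed

text \<open>An involution outside \<open>V\<close> serves as the shift for all self-inverse cosets
  at once. Without one, the number of squares in \<open>V\<close> decides which special tile is
  used.\<close>

lemma ex_tile_cover:
  assumes n: "order G = 16 * m" "m > 0"
  shows "\<exists>T. (\<forall>t<m. zero_tile G (T t)) \<and> carrier G \<subseteq> (\<Union>t<m. tile_cells (T t))"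
proof (cases "involutions G \<subseteq> V")
  case False
  then obtain d where d: "d \<in> carrier G" "d \<otimes> d = \<one>" "d \<notin> V" by (auto simp: involutions_def)
  show ?thesis
  proof (rule tiles_of_closed_set(2)[where d = d])
    show "card (carrier G) = 16 * m" using n by (simp add: order_def)
  qed (use d coset_subset in simp_all)
next
  case inv: True
  \<comment> \<open>Otherwise \<open>V\<close> would be the only self-inverse coset, and its
    complement would be a union of disjoint dominoes, although 16 m - 4 is not divisible by
    8.\<close>
  have "\<exists>q\<in>carrier G. q \<otimes> q \<in> V \<and> q \<otimes> q \<noteq> \<one>"
  proof (rule ccontr)
    assume none: "\<not> ?thesis"
    have self: "x \<in> V" if "x \<in> carrier G" "x \<otimes> x \<in> V" for x
    proof -
      have "x \<otimes> x = \<one> \<otimes> \<one>" using none that by auto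
      then show ?thesis using coset_if_square_eq[OF inv that(1), of \<one>] V_trivial_coset by simp
    qed
    have "8 dvd card (carrier G - V)"
    proof (rule tiles_of_closed_set(1)[where d = \<one>])
      fix x assume x: "x \<in> carrier G - V"
      then have "inv x \<notin> V" using V.m_inv_closed[of "inv x"] inv_inv[of x] by auto
      then show "inv x \<in> carrier G - V" using x by simp
      have "x \<in> V" if "y \<in> V #> x" "y \<in> V" for y
      proof -
        have "V #> x = V" using coset_eq[of x y] coset_eq[of \<one> y] x that V_trivial_coset by simp
        then show ?thesis using coset_self[of x] x by blast
      qed
      then show "V #> x \<subseteq> carrier G - V" using coset_subset x by blast
      assume "x \<otimes> x \<in> V"
      then have "x \<in> V" using self[of x] x by blast
      then show "\<one> \<notin> V \<and> x \<otimes> \<one> \<in> carrier G - V" using x by blast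
    qed auto
    moreover have "card (carrier G - V) = 16 * m - 4"
      using n finite_V V.subset card_V by (simp add: card_Diff_subset order_def)
    ultimately show False using n by presburger
  qed
  then obtain q where q: "q \<in> carrier G" "q \<otimes> q \<in> V" "q \<otimes> q \<noteq> \<one>" by blast
  show ?thesis
  proof (cases "\<exists>y\<in>carrier G. y \<otimes> y \<in> V \<and> y \<otimes> y \<noteq> \<one> \<and> y \<otimes> y \<noteq> q \<otimes> q")
    case True
    then show ?thesis using tile_cover_all_squares[OF inv q] n by blast
  next
    case False
    \<comment> \<open>Otherwise the cosets \<open>V\<close> and \<open>V #> q\<close> would exhaust
      the group, giving at most 8 elements where there are at least 16.\<close>
    have "\<exists>y\<in>carrier G. y \<otimes> y \<notin> V"
    proof (rule ccontr)
      assume all: "\<not> ?thesis"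
      have "x \<in> V \<union> (V #> q)" if "x \<in> carrier G" for x
      proof -
        have "x \<otimes> x = \<one> \<otimes> \<one> \<or> x \<otimes> x = q \<otimes> q" using False all that by auto
        then show ?thesis
          using coset_if_square_eq[OF inv that, of \<one>] coset_if_square_eq[OF inv that q(1)] V_trivial_coset by auto
      qed
      then have "carrier G \<subseteq> V \<union> (V #> q)" by blast
      moreover have "finite (V \<union> (V #> q))" using coset_subset[OF q(1)] finite_carrier finite_V finite_subset by blast
      ultimately have "order G \<le> card V + card (V #> q)"
        unfolding order_def by (meson card_Un_le card_mono order.trans)
      then show False using n card_V card_coset[OF q(1)] by simp
    qed
    then obtain y where "y \<in> carrier G" "y \<otimes> y \<notin> V" by blast
    then show ?thesis using tile_cover_one_square[OF inv q _ _ _ n] False by blast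
  qed
qed

end

section \<open>Assembly of the cases\<close>

lemma (in comm_group) ex_magic_square_quadruple:
  assumes n: "order G = (4 * k)\<^sup>2" "k > 0" and inv: "card (involutions G) > 1"
  shows "\<exists>A. zero_sum_magic_square G (4 * k) A"
proof -
  have fin: "finite (carrier G)" using n order_gt_0_iff_finite by fastforce
  obtain a b where ab: "a \<in> involutions G" "b \<in> involutions G" "a \<noteq> b"
    using inv by (metis One_nat_def card_le_Suc0_iff_eq card.infinite not_less not_less_zero)
  define V where "V = {\<one>, a, b, a \<otimes> b}"
  have G: "a \<in> carrier G" "b \<in> carrier G" "a \<otimes> a = \<one>" "b \<otimes> b = \<one>"
    using ab by (auto simp: involutions_def)
  have "(a \<otimes> b) \<otimes> (a \<otimes> b) = (a \<otimes> a) \<otimes> (b \<otimes> b)" using G(1,2) by (simp add: m_ac)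
  then have sq: "v \<otimes> v = \<one>" if "v \<in> V" for v using that G by (auto simp: V_def)
  have "subgroup V G" "card V = 4" using klein_subgroup[OF ab] by (simp_all add: V_def)
  then interpret klein G V
    using fin sq by (intro klein.intro klein_axioms.intro comm_group_axioms)
  have "order G = 16 * (k * k)" using n by (simp add: power2_eq_square)
  then obtain T where "\<forall>t<k * k. zero_tile G (T t)" "carrier G \<subseteq> (\<Union>t<k * k. tile_cells (T t))"
    using ex_tile_cover n(2) by (metis nat_0_less_mult_iff)
  then show ?thesis using ex_magic_square_of_tiles[OF n(1)] by blast
qed

theorem theorem1p3:
  fixes G :: "('a, 'b) monoid_scheme" and n :: nat
  assumes "n > 0"
    and "comm_group G"
    and "order G = n\<^sup>2"
    and "n\<^sup>2 > 1"
  shows "(\<exists>A. zero_sum_magic_square G n A) \<longleftrightarrow> n > 2 \<and> class_G G"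
proof
  interpret comm_group G by fact
  assume "\<exists>A. zero_sum_magic_square G n A"
  then obtain A where A: "zero_sum_magic_square G n A" by blast
  have "n \<noteq> 1" using assms(4) by auto
  moreover have "n \<noteq> 2" using A no_magic_square_2 by blast
  ultimately show "n > 2 \<and> class_G G"
    using assms(1) magic_square_imp_class_G[OF assms(1,3) A] by auto
next
  interpret comm_group G by fact
  assume R: "n > 2 \<and> class_G G"
  show "\<exists>A. zero_sum_magic_square G n A"
  proof (cases "odd n")
    case True
    then show ?thesis using ex_magic_square_odd[OF assms(3)] R by simp
  next
    case False
    then have inv: "card (involutions G) > 1" using R assms(3) by (simp add: class_G_def)
    obtain m where m: "n = 2 * m" using False by blast
    show ?thesis
    proof (cases "odd m")
      case True
      then show ?thesis using ex_magic_square_twice_odd[of m] inv assms(3) R m by simp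
    next
      case False
      then obtain k where "m = 2 * k" by blast
      then have "n = 4 * k" "k > 0" using m R by auto
      then show ?thesis using ex_magic_square_quadruple[of k] inv assms(3) by simp
    qed
  qed
qed

end
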